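(* Fix $\alpha_0>0$. Suppose that $\beta_m$ satisfies either $m\beta_m\to\infty$ or $m\beta_m\to 0$ as $m\to\infty$. Then the limits $$c_k=\lim_{m\to\infty}\mathbb P(C^m(\infty)=k),\qquad k\in\mathcal K,$$ exist. Furthermore: 1. (Memory-abundant regime) Suppose that $m\beta_m\to\infty$ as $m\to\infty$. If $\alpha_0\le \lambda_1/K$, then $$c_1=1-\frac{K-1}{\lambda_1}\alpha_0,\qquad c_k=\frac{\alpha_0}{\lambda_1},\quad k=2,\dots,K.$$ If $\alpha_0>\lambda_1/K$, then $c_k=1/K$ for $k=1,\dots,K$. 2. (Memory-deficient regime) Suppose that $m\beta_m\to 0$ as $m\to\infty$. Then $$c_k=\frac{\lambda_k\vee\alpha_0+(K-1)\alpha_0}{\sum_{i\in\mathcal K}\left[\lambda_i\vee\alpha_0+(K-1)\alpha_0\right]},\qquad k=1,\dots,K.$$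
   Context: Write $x\vee y=\max\{x,y\}$. Let $K$ be a positive integer, $\mathcal K=\{1,\dots,K\}$ (the set of actions), and let the reward rates satisfy $\lambda_1>\lambda_2\ge\dots\ge\lambda_K>0$. For each $m\in\mathbb N$ let $\beta_m>0$ (update rate) and $\alpha_m=\alpha_0 m$, where $\alpha_0>0$ is fixed. The $m$-th system is the right-continuous continuous-time Markov jump process $W^m(t)=(Q^m(t),C^m(t))$ on $\mathbb Z_+^K\times\mathcal K$ with the following dynamics. (i) Arrivals: $Q^m_k$ increases by $1$ at rate $\lambda_k$ if $C^m(t)=k$, and at rate $0$ otherwise. (ii) Departures: $Q^m_k$ decreases by $1$ at rate $Q^m_k(t)/m$ (each unit of reward has an independent exponential lifespan with mean $m$). (iii) Updates: update points form an independent Poisson process of rate $\beta_m$; at an update point at time $t$, $C^m$ is replaced by a new choice (possibly equal to the old one), equal to $k$ with conditional probability $\frac{Q^m_k(t)\vee\alpha_m}{\sum_{i\in\mathcal K}(Q^m_i(t)\vee\alpha_m)}$ given the past, and $C^m$ is constant between update points. $(Q^m(\infty),C^m(\infty))$ denotes a random vector distributed according to the stationary distribution of $W^m$. *)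

theory Defs
  imports "HOL-Probability.Probability"
begin

text \<open>
  \<open>P t x\<close> is the law at time \<open>t\<close> of a chain started in \<open>x\<close>. The function \<open>P\<close> is an honest
  transition function on the countable state space \<open>S\<close> whose derivative at \<open>0\<close> is given by the
  jump rates \<open>q\<close>. Only the off-diagonal values of \<open>q\<close> matter; the diagonal of the generator is
  minus the total jump rate.
\<close>
definition transition_function ::
    "'s set \<Rightarrow> ('s \<Rightarrow> 's \<Rightarrow> real) \<Rightarrow> (real \<Rightarrow> 's \<Rightarrow> 's pmf) \<Rightarrow> bool" where
  "transition_function S q P \<longleftrightarrow>
     (\<forall>x\<in>S. P 0 x = return_pmf x) \<and>
     (\<forall>t\<ge>0. \<forall>x\<in>S. set_pmf (P t x) \<subseteq> S) \<and>
     (\<forall>s\<ge>0. \<forall>t\<ge>0. \<forall>x\<in>S. P (s + t) x = bind_pmf (P s x) (P t)) \<and>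
     (\<forall>x\<in>S. \<forall>y\<in>S. x \<noteq> y \<longrightarrow> ((\<lambda>t. pmf (P t x) y / t) \<longlongrightarrow> q x y) (at_right 0)) \<and>
     (\<forall>x\<in>S. q x summable_on (S - {x}) \<and>
        ((\<lambda>t. (1 - pmf (P t x) x) / t) \<longlongrightarrow> (\<Sum>\<^sub>\<infinity>y\<in>S - {x}. q x y)) (at_right 0))"

text \<open>
  The process \<open>(W t)\<^sub>t\<^sub>\<ge>\<^sub>0\<close> on the probability space \<open>M\<close>: right-continuity of paths is with respect
  to the discrete topology on \<open>S\<close>, and the last conjunct is the Markov property with (time
  homogeneous) transition function \<open>P\<close>. The initial law is arbitrary.
\<close>
definition markov_jump_process ::
    "'s set \<Rightarrow> ('s \<Rightarrow> 's \<Rightarrow> real) \<Rightarrow> (real \<Rightarrow> 's \<Rightarrow> 's pmf) \<Rightarrow>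
     'w measure \<Rightarrow> (real \<Rightarrow> 'w \<Rightarrow> 's) \<Rightarrow> bool" where
  "markov_jump_process S q P M W \<longleftrightarrow>
     transition_function S q P \<and>
     prob_space M \<and>
     (\<forall>t\<ge>0. W t \<in> measurable M (count_space S)) \<and>
     (\<forall>\<omega>\<in>space M. \<forall>t\<ge>0. eventually (\<lambda>s. W s \<omega> = W t \<omega>) (at_right t)) \<and>
     (\<forall>(n::nat) (\<tau>::nat \<Rightarrow> real) (x::nat \<Rightarrow> 's).
        0 \<le> \<tau> 0 \<and> (\<forall>i\<le>n. \<tau> i < \<tau> (Suc i)) \<and> (\<forall>i\<le>Suc n. x i \<in> S) \<longrightarrow>
        measure M {\<omega>\<in>space M. \<forall>i\<le>Suc n. W (\<tau> i) \<omega> = x i} =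
        measure M {\<omega>\<in>space M. \<forall>i\<le>n. W (\<tau> i) \<omega> = x i} *
          pmf (P (\<tau> (Suc n) - \<tau> n) (x n)) (x (Suc n)))"

definition stationary_distribution ::
    "'s set \<Rightarrow> (real \<Rightarrow> 's \<Rightarrow> 's pmf) \<Rightarrow> 's pmf \<Rightarrow> bool" where
  "stationary_distribution S P \<pi> \<longleftrightarrow>
     set_pmf \<pi> \<subseteq> S \<and> (\<forall>t\<ge>0. bind_pmf \<pi> (P t) = \<pi>)"

text \<open>
  A state is a pair \<open>(Q, c)\<close> of the reward vector, encoded as a function vanishing outside
  \<open>{1..K}\<close>, and the current action.
\<close>
type_synonym state = "(nat \<Rightarrow> nat) \<times> nat"

definition states :: "nat \<Rightarrow> state set" where
  "states K = {(Q, c). (\<forall>k. k \<notin> {1..K} \<longrightarrow> Q k = 0) \<and> c \<in> {1..K}}"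

definition choice_prob :: "nat \<Rightarrow> real \<Rightarrow> (nat \<Rightarrow> nat) \<Rightarrow> nat \<Rightarrow> real" where
  "choice_prob K a Q k = max (real (Q k)) a / (\<Sum>i=1..K. max (real (Q i)) a)"

text \<open>
  Jump rates of a system with arrival rates \<open>lam\<close>, threshold \<open>a\<close>, update rate \<open>b\<close> and mean
  lifespan \<open>m\<close>; the three summands are arrivals, departures and updates. A departure with
  \<open>Q k = 0\<close> has rate \<open>0\<close>, and an update that keeps the action contributes to the (irrelevant)
  diagonal only.
\<close>
definition jump_rate ::
    "nat \<Rightarrow> (nat \<Rightarrow> real) \<Rightarrow> real \<Rightarrow> real \<Rightarrow> nat \<Rightarrow> state \<Rightarrow> state \<Rightarrow> real" where
  "jump_rate K lam a b m = (\<lambda>(Q, c) (Q', c').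
     (if Q' = Q(c := Q c + 1) \<and> c' = c then lam c else 0) +
     (\<Sum>k=1..K. if Q' = Q(k := Q k - 1) \<and> c' = c then real (Q k) / real m else 0) +
     (if Q' = Q then b * choice_prob K a Q c' else 0))"

end

theory Submission
  imports Defs
begin

text \<open>
  Everything follows from stationarity, in the form \<open>E (L f) = 0\<close> for the generator \<open>L\<close> and
  suitable test functions \<open>f\<close>; neither a fluid limit nor weak convergence enters. Write
  \<open>x\<^sub>k = Q\<^sub>k / m\<close>, \<open>z\<^sub>k = max x\<^sub>k \<alpha>\<close> with \<open>\<alpha> = \<alpha>\<^sub>0\<close>, and \<open>S = \<Sum>\<^sub>k z\<^sub>k\<close>, so that an update chooses \<open>k\<close> with
  probability \<open>z\<^sub>k / S\<close>. The test functions are products \<open>h(c) \<psi>(Q\<^sub>k)\<close> of a function of the action and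
  a function of one reward coordinate (\<open>balance_product\<close>). In particular
  \<open>P(c = k) = E (z\<^sub>k / S)\<close> and \<open>E x\<^sub>k = \<lambda>\<^sub>k P(c = k)\<close>.
  
  \<^bold>\<open>Abundant memory\<close>, \<open>m \<beta>\<^sub>m \<rightarrow> \<infinity>\<close>. Updates are so frequent that the indicator of \<open>c = k\<close> may be
  replaced by \<open>z\<^sub>k / S\<close> when tested against a smooth function of \<open>x\<^sub>k\<close>. Hence
  \<open>E (\<phi>(x\<^sub>k) (\<lambda>\<^sub>k z\<^sub>k / S - x\<^sub>k)) \<rightarrow> 0\<close>, and the two choices \<open>\<phi> = 1\<close> and \<open>\<phi> = 1 / z\<^sub>k\<close> suffice. The second
  one gives \<open>\<lambda>\<^sub>k E (1 / S) = E (x\<^sub>k / z\<^sub>k) + o(1) \<le> 1 + o(1)\<close>. Together they give, for the excess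
  \<open>y\<^sub>k = z\<^sub>k - \<alpha>\<close>, the relation \<open>\<lambda>\<^sub>k E (y\<^sub>k / S) = E y\<^sub>k + o(1)\<close>. Summing the latter over \<open>k\<close>, with
  \<open>\<lambda>\<^sub>k \<le> \<lambda>\<^sub>1\<close> and \<open>\<Sum>\<^sub>k y\<^sub>k = S - K \<alpha>\<close>, yields
  \<open>E ((S - \<lambda>\<^sub>1)\<^sup>2 / S) \<le> (\<lambda>\<^sub>1 - K \<alpha>) (\<lambda>\<^sub>1 E (1 / S) - 1) + o(1)\<close>. If \<open>K \<alpha> \<le> \<lambda>\<^sub>1\<close>, the right-hand side is at
  most \<open>o(1)\<close> by the first relation with \<open>k = 1\<close>. So \<open>S\<close> concentrates at \<open>\<lambda>\<^sub>1\<close>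
  (\<open>normalizer_variance\<close>), and then \<open>\<lambda>\<^sub>k E (y\<^sub>k / S) = E y\<^sub>k + o(1)\<close> with \<open>\<lambda>\<^sub>k < \<lambda>\<^sub>1\<close> forces
  \<open>E y\<^sub>k \<rightarrow> 0\<close> and \<open>P(c = k) = E (y\<^sub>k / S) + \<alpha> E (1 / S) \<rightarrow> \<alpha> / \<lambda>\<^sub>1\<close>. If \<open>K \<alpha> > \<lambda>\<^sub>1\<close>, then
  \<open>S \<ge> K \<alpha> > \<lambda>\<^sub>k\<close> forces \<open>E y\<^sub>k \<rightarrow> 0\<close> for all \<open>k\<close> at once, and \<open>P(c = k) \<rightarrow> 1 / K\<close>.
  
  \<^bold>\<open>Deficient memory\<close>, \<open>m \<beta>\<^sub>m \<rightarrow> 0\<close>. Between two updates the rewards have time to equilibrate: on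
  \<open>c = k\<close> the coordinate \<open>x\<^sub>k\<close> concentrates at \<open>\<lambda>\<^sub>k\<close> and the other coordinates vanish. An update then
  chooses with probabilities depending on the current action only, so the actions approach the
  stationary law of an explicit Markov chain on \<open>{1..K}\<close> (\<open>deficient_bound\<close>).
  
  That \<open>E (L f) = 0\<close> holds needs an argument because the rates are unbounded. Truncated test
  functions give \<open>E (\<Sum>\<^sub>k Q\<^sub>k) < \<infinity>\<close> (\<open>stationary_drift_nonpos\<close>), which dominates the difference
  quotients of the transition function (\<open>stationary_generator\<close>).
\<close>

section \<open>Difference quotients of a transition function\<close>

lemma integral_bind_pmf_bounded:
  fixes f :: "'b \<Rightarrow> real"
  assumes "\<And>y. \<bar>f y\<bar> \<le> B"
  shows "(\<integral>y. f y \<partial>bind_pmf p k) = (\<integral>x. (\<integral>y. f y \<partial>k x) \<partial>p)"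
  unfolding measure_pmf_bind
  by (rule integral_bind[where K = "count_space UNIV" and B = B and B' = 1])
     (use assms measurable_measure_pmf[of k] in
       \<open>auto simp: measure_pmf.emeasure_space_1 measure_pmf.finite_measure_axioms\<close>)

lemma integrable_measure_pmf_bounded:
  fixes f :: "'a \<Rightarrow> real"
  assumes "\<And>x. x \<in> set_pmf p \<Longrightarrow> \<bar>f x\<bar> \<le> B"
  shows "integrable (measure_pmf p) f"
  by (rule measure_pmf.integrable_const_bound[where B = B])
     (use assms in \<open>auto simp: AE_measure_pmf_iff\<close>)

lemma one_minus_power_le:
  fixes p :: real
  assumes "0 \<le> p"
  shows "1 - p ^ n \<le> real n * (1 - p)"
  using Bernoulli_inequality[of "p - 1" n] assms by (simp add: algebra_simps)

lemma transition_functionD: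
  assumes "transition_function S q P" and "x \<in> S"
  shows "P 0 x = return_pmf x"
    and "\<lbrakk>0 \<le> s; 0 \<le> t\<rbrakk> \<Longrightarrow> P (s + t) x = bind_pmf (P s x) (P t)"
    and "\<lbrakk>y \<in> S; x \<noteq> y\<rbrakk> \<Longrightarrow> ((\<lambda>t. pmf (P t x) y / t) \<longlongrightarrow> q x y) (at_right 0)"
    and "((\<lambda>t. (1 - pmf (P t x) x) / t) \<longlongrightarrow> (\<Sum>\<^sub>\<infinity>y\<in>S - {x}. q x y)) (at_right 0)"
  using assms unfolding transition_function_def by blast+

text \<open>
  The return probability \<open>p t\<close> is supermultiplicative, so \<open>1 - p t \<le> 1 - p (t / n)\<^sup>n\<close>, which
  Bernoulli's inequality bounds by \<open>n (1 - p (t / n))\<close>; now let \<open>n\<close> grow. This uniform bound is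
  what dominates the difference quotients at \<open>t = 0\<close>.
\<close>

lemma transition_exit_bound:
  assumes tf: "transition_function S q P" and x: "x \<in> S" and t: "0 \<le> t"
  shows "1 - pmf (P t x) x \<le> t * (\<Sum>\<^sub>\<infinity>y\<in>S - {x}. q x y)"
proof (cases "t = 0")
  case True
  then show ?thesis using transition_functionD(1)[OF tf x] by simp
next
  case False
  with t have t: "t > 0" by simp
  define p where "p = (\<lambda>t. pmf (P t x) x)"
  let ?q = "\<Sum>\<^sub>\<infinity>y\<in>S - {x}. q x y"
  have p01: "0 \<le> p s" "p s \<le> 1" for s by (simp_all add: p_def pmf_le_1)
  have p0: "p 0 = 1" using transition_functionD(1)[OF tf x] by (simp add: p_def)
  have super: "p (s + r) \<ge> p s * p r" if "0 \<le> s" "0 \<le> r" for s r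
  proof -
    have "P (s + r) x = bind_pmf (P s x) (P r)"
      by (rule transition_functionD(2)[OF tf x that])
    then have "p (s + r) = (\<integral>y. pmf (P r y) x \<partial>P s x)"
      by (simp add: p_def pmf_bind)
    also have "\<dots> \<ge> (\<integral>y. indicator {x} y * p r \<partial>P s x)"
      by (intro integral_mono integrable_measure_pmf_bounded[where B = 1])
         (auto simp: p_def pmf_le_1 indicator_def)
    also have "(\<integral>y. indicator {x} y * p r \<partial>P s x) = p s * p r"
      by (simp add: p_def pmf.rep_eq)
    finally show ?thesis .
  qed
  have pow: "p (real n * s) \<ge> p s ^ n" if "0 \<le> s" for n s
  proof (induction n)
    case 0
    show ?case by (simp add: p0)
  next
    case (Suc n)
    have "p s ^ Suc n \<le> p s * p (real n * s)"
      using Suc p01[of s] by (simp add: mult_left_mono)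
    also have "\<dots> \<le> p (s + real n * s)"
      using super[of s "real n * s"] that by simp
    finally show ?case by (simp add: algebra_simps)
  qed
  have step: "1 - p t \<le> t * ((1 - p (t / real (Suc n))) / (t / real (Suc n)))" for n
  proof -
    have "1 - p t \<le> 1 - p (t / real (Suc n)) ^ Suc n"
      using pow[of "t / real (Suc n)" "Suc n"] t by (simp del: of_nat_Suc power_Suc)
    also have "\<dots> \<le> real (Suc n) * (1 - p (t / real (Suc n)))"
      by (rule one_minus_power_le) (rule p01)
    also have "\<dots> = t * ((1 - p (t / real (Suc n))) / (t / real (Suc n)))"
      using t by simp
    finally show ?thesis .
  qed
  have "((\<lambda>s. (1 - p s) / s) \<longlongrightarrow> ?q) (at_right 0)"
    unfolding p_def by (rule transition_functionD(4)[OF tf x])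
  moreover have "filterlim (\<lambda>n. t / real (Suc n)) (at_right 0) sequentially"
    unfolding filterlim_at using t LIMSEQ_Suc[OF lim_const_over_n[of t]] by auto
  ultimately have "(\<lambda>n. (1 - p (t / real (Suc n))) / (t / real (Suc n))) \<longlonglongrightarrow> ?q"
    by (rule filterlim_compose)
  then have "(\<lambda>n. t * ((1 - p (t / real (Suc n))) / (t / real (Suc n)))) \<longlonglongrightarrow> t * ?q"
    by (rule tendsto_mult_left)
  then have "1 - p t \<le> t * ?q"
    by (rule LIMSEQ_le_const) (use step in blast)
  then show ?thesis by (simp add: p_def)
qed

section \<open>Stationary laws annihilate the generator\<close>

text \<open>
  \<open>A x\<close> is a finite set containing all states reachable from \<open>x\<close> in one jump. It may contain \<open>x\<close>
  itself: the generator does not see the diagonal of \<open>q\<close>, and the exit rate then only grows.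
\<close>

locale stationary_chain =
  fixes S :: "'s set" and q :: "'s \<Rightarrow> 's \<Rightarrow> real" and P :: "real \<Rightarrow> 's \<Rightarrow> 's pmf"
    and \<pi> :: "'s pmf" and A :: "'s \<Rightarrow> 's set"
  assumes tf: "transition_function S q P"
    and stat: "stationary_distribution S P \<pi>"
    and finite_A: "x \<in> S \<Longrightarrow> finite (A x)"
    and A_subset: "x \<in> S \<Longrightarrow> A x \<subseteq> S"
    and q_outside: "x \<in> S \<Longrightarrow> y \<in> S \<Longrightarrow> y \<notin> A x \<Longrightarrow> q x y = 0"
    and q_nonneg: "x \<in> S \<Longrightarrow> 0 \<le> q x y"
begin

definition gen :: "('s \<Rightarrow> real) \<Rightarrow> 's \<Rightarrow> real" where
  "gen f x = (\<Sum>y\<in>A x. q x y * (f y - f x))"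

definition exit_rate :: "'s \<Rightarrow> real" where
  "exit_rate x = (\<Sum>y\<in>A x. q x y)"

lemma set_pi: "set_pmf \<pi> \<subseteq> S"
  using stat by (simp add: stationary_distribution_def)

lemma infsum_rates:
  assumes "x \<in> S"
  shows "(\<Sum>\<^sub>\<infinity>y\<in>S - {x}. q x y) = (\<Sum>y\<in>A x - {x}. q x y)"
proof -
  have "(\<Sum>\<^sub>\<infinity>y\<in>S - {x}. q x y) = (\<Sum>\<^sub>\<infinity>y\<in>A x - {x}. q x y)"
    by (rule infsum_cong_neutral) (use q_outside A_subset assms in auto)
  then show ?thesis using finite_A[OF assms] by simp
qed

lemma infsum_rates_le:
  assumes "x \<in> S"
  shows "(\<Sum>\<^sub>\<infinity>y\<in>S - {x}. q x y) \<le> exit_rate x"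
  unfolding infsum_rates[OF assms] exit_rate_def
  by (rule sum_mono2) (use finite_A q_nonneg assms in auto)

lemma difference_quotient_bound:
  assumes x: "x \<in> S" and t: "0 < t" and f: "\<And>y. \<bar>f y\<bar> \<le> B"
  shows "\<bar>((\<integral>y. f y \<partial>P t x) - f x) / t\<bar> \<le> 2 * B * exit_rate x"
proof -
  have B: "0 \<le> B" using f[of x] by linarith
  have "(\<integral>y. f y \<partial>P t x) - f x = (\<integral>y. f y - f x \<partial>P t x)"
    using integrable_measure_pmf_bounded[of "P t x" f B, OF f] by simp
  also have "\<bar>\<dots>\<bar> \<le> (\<integral>y. \<bar>f y - f x\<bar> \<partial>P t x)"
    by (rule integral_abs_bound)
  also have "\<dots> \<le> (\<integral>y. 2 * B * indicator (- {x}) y \<partial>P t x)"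
  proof (intro integral_mono integrable_measure_pmf_bounded[where B = "2 * B"])
    fix y
    have "\<bar>f y - f x\<bar> \<le> 2 * B" using f[of x] f[of y] by linarith
    then show "\<bar>f y - f x\<bar> \<le> 2 * B * indicator (- {x}) y" "\<bar>\<bar>f y - f x\<bar>\<bar> \<le> 2 * B"
      by (auto simp: indicator_def)
    show "\<bar>2 * B * indicator (- {x}) y\<bar> \<le> 2 * B" using B by (auto simp: indicator_def)
  qed
  also have "\<dots> = 2 * B * (1 - pmf (P t x) x)"
    using measure_pmf.prob_compl[of "{x}" "P t x"] by (simp add: pmf.rep_eq Compl_eq_Diff_UNIV)
  also have "\<dots> \<le> 2 * B * (t * exit_rate x)"
    using transition_exit_bound[OF tf x, of t] infsum_rates_le[OF x] t B
    by (intro mult_left_mono order.trans[OF transition_exit_bound[OF tf x, of t]]) auto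
  finally show ?thesis using t by (simp add: field_simps)
qed

text \<open>
  The finitely many one-jump targets contribute the generator. The probability of being
  elsewhere is \<open>o(t)\<close>, because the rates into \<open>A x - {x}\<close> exhaust the total exit rate.
\<close>

lemma difference_quotient_tendsto:
  assumes x: "x \<in> S" and f: "\<And>y. \<bar>f y\<bar> \<le> B"
  shows "((\<lambda>t. ((\<integral>y. f y \<partial>P t x) - f x) / t) \<longlongrightarrow> gen f x) (at_right 0)"
proof -
  let ?A = "A x - {x}"
  have fin: "finite ?A" using finite_A[OF x] by simp
  have B: "0 \<le> B" using f[of x] by linarith
  have jump: "((\<lambda>t. pmf (P t x) y / t) \<longlongrightarrow> q x y) (at_right 0)" if "y \<in> ?A" for y
    using that A_subset[OF x] by (intro transition_functionD(3)[OF tf x]) auto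
  have exit: "((\<lambda>t. (1 - pmf (P t x) x) / t) \<longlongrightarrow> (\<Sum>y\<in>?A. q x y)) (at_right 0)"
    unfolding infsum_rates[OF x, symmetric] by (rule transition_functionD(4)[OF tf x])
  define main where "main = (\<lambda>t. \<Sum>y\<in>?A. pmf (P t x) y / t * (f y - f x))"
  define rest where "rest = (\<lambda>t. (1 - pmf (P t x) x) / t - (\<Sum>y\<in>?A. pmf (P t x) y / t))"
  have "gen f x = (\<Sum>y\<in>?A. q x y * (f y - f x))"
    unfolding gen_def using finite_A[OF x] by (intro sum.mono_neutral_right) auto
  then have main: "(main \<longlongrightarrow> gen f x) (at_right 0)"
    unfolding main_def by (simp only:) (intro tendsto_sum tendsto_mult jump tendsto_const)
  have "(rest \<longlongrightarrow> (\<Sum>y\<in>?A. q x y) - (\<Sum>y\<in>?A. q x y)) (at_right 0)"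
    unfolding rest_def by (intro tendsto_diff exit tendsto_sum jump) auto
  then have rest: "((\<lambda>t. 2 * B * rest t) \<longlongrightarrow> 0) (at_right 0)"
    by (auto intro: tendsto_eq_intros)
  have bound: "\<bar>((\<integral>y. f y \<partial>P t x) - f x) / t - main t\<bar> \<le> 2 * B * rest t" if t: "0 < t" for t
  proof -
    let ?I = "insert x ?A"
    have df: "\<bar>f y - f x\<bar> \<le> 2 * B" for y using f[of x] f[of y] by linarith
    have int: "integrable (P t x) (\<lambda>y. (f y - f x) * indicator X y)" for X
      by (rule integrable_measure_pmf_bounded[where B = "2 * B"])
         (use df B in \<open>auto simp: indicator_def\<close>)
    have "(\<integral>y. f y \<partial>P t x) - f x = (\<integral>y. f y - f x \<partial>P t x)"
      using integrable_measure_pmf_bounded[of "P t x" f B, OF f] by simp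
    also have "\<dots> = (\<integral>y. (f y - f x) * indicator ?A y + (f y - f x) * indicator (- ?I) y \<partial>P t x)"
      by (rule Bochner_Integration.integral_cong) (auto simp: indicator_def)
    also have "\<dots> = (\<integral>y. (f y - f x) * indicator ?A y \<partial>P t x)
        + (\<integral>y. (f y - f x) * indicator (- ?I) y \<partial>P t x)"
      by (intro Bochner_Integration.integral_add int)
    also have "(\<integral>y. (f y - f x) * indicator ?A y \<partial>P t x)
        = (\<Sum>y\<in>?A. ((f y - f x) * indicator ?A y) * pmf (P t x) y)"
      by (rule integral_measure_pmf_real) (use fin in \<open>auto simp: indicator_def\<close>)
    also have "\<dots> = main t * t"
      unfolding main_def sum_distrib_right using t by (intro sum.cong) auto
    finally have eq: "((\<integral>y. f y \<partial>P t x) - f x) / t - main t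
        = (\<integral>y. (f y - f x) * indicator (- ?I) y \<partial>P t x) / t"
      using t by (simp add: field_simps)
    have "\<bar>\<integral>y. (f y - f x) * indicator (- ?I) y \<partial>P t x\<bar>
        \<le> (\<integral>y. \<bar>(f y - f x) * indicator (- ?I) y\<bar> \<partial>P t x)"
      by (rule integral_abs_bound)
    also have "\<dots> \<le> (\<integral>y. 2 * B * indicator (- ?I) y \<partial>P t x)"
      by (intro integral_mono integrable_measure_pmf_bounded[where B = "2 * B"])
         (use df B in \<open>auto simp: indicator_def abs_mult\<close>)
    also have "\<dots> = 2 * B * (1 - measure (P t x) ?I)"
      using measure_pmf.prob_compl[of ?I "P t x"] by (simp add: Compl_eq_Diff_UNIV)
    also have "measure (P t x) ?I = pmf (P t x) x + (\<Sum>y\<in>?A. pmf (P t x) y)"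
      using fin by (simp add: measure_measure_pmf_finite del: insert_Diff_single)
    finally have "\<bar>\<integral>y. (f y - f x) * indicator (- ?I) y \<partial>P t x\<bar> / t
        \<le> 2 * B * (1 - (pmf (P t x) x + (\<Sum>y\<in>?A. pmf (P t x) y))) / t"
      using t by (simp add: divide_right_mono)
    also have "\<dots> = 2 * B * rest t"
      by (simp add: rest_def sum_divide_distrib[symmetric] diff_divide_distrib[symmetric]
          algebra_simps)
    finally show ?thesis using t by (simp add: eq)
  qed
  have "((\<lambda>t. ((\<integral>y. f y \<partial>P t x) - f x) / t - main t) \<longlongrightarrow> 0) (at_right 0)"
    by (rule Lim_null_comparison[OF _ rest])
       (use bound in \<open>auto simp: eventually_at_filter intro!: always_eventually\<close>)
  from tendsto_add[OF this main] show ?thesis by simp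
qed

lemma stationary_difference_quotient:
  assumes t: "0 < t" and f: "\<And>y. \<bar>f y\<bar> \<le> B"
  shows "(\<integral>x. ((\<integral>y. f y \<partial>P t x) - f x) / t \<partial>\<pi>) = 0"
proof -
  have bd: "\<bar>\<integral>y. f y \<partial>P t x\<bar> \<le> B" for x
  proof -
    have "\<bar>\<integral>y. f y \<partial>P t x\<bar> \<le> (\<integral>y. \<bar>f y\<bar> \<partial>P t x)" by (rule integral_abs_bound)
    also have "\<dots> \<le> (\<integral>y. B \<partial>P t x)"
      by (intro integral_mono integrable_measure_pmf_bounded[where B = B])
         (use f order.trans[OF abs_ge_zero f] in auto)
    finally show ?thesis by simp
  qed
  have "(\<integral>x. ((\<integral>y. f y \<partial>P t x) - f x) / t \<partial>\<pi>)
      = ((\<integral>x. (\<integral>y. f y \<partial>P t x) \<partial>\<pi>) - (\<integral>x. f x \<partial>\<pi>)) / t"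
    using integrable_measure_pmf_bounded[of \<pi> f B, OF f]
      integrable_measure_pmf_bounded[of \<pi> "\<lambda>x. \<integral>y. f y \<partial>P t x" B, OF bd]
    by simp
  also have "(\<integral>x. (\<integral>y. f y \<partial>P t x) \<partial>\<pi>) = (\<integral>x. f x \<partial>\<pi>)"
    using integral_bind_pmf_bounded[of f B \<pi> "P t", OF f] stat t
    by (simp add: stationary_distribution_def)
  finally show ?thesis by simp
qed

text \<open>
  Stationarity kills the integral of the difference quotient over all states. Outside \<open>H\<close>, where
  \<open>f\<close> attains its minimum \<open>0\<close>, the quotient is nonnegative, so its integral over \<open>H\<close> is at most
  \<open>0\<close>. As \<open>H\<close> is finite, the limit \<open>t \<rightarrow> 0\<close> can be taken termwise, without any integrability of
  the rates; this is how the first moments are obtained.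
\<close>

lemma stationary_drift_nonpos:
  assumes f: "\<And>y. 0 \<le> f y" "\<And>y. f y \<le> B"
    and H: "finite H" "H \<subseteq> S" "\<And>y. y \<notin> H \<Longrightarrow> f y = 0"
  shows "(\<Sum>x\<in>H. pmf \<pi> x * gen f x) \<le> 0"
proof -
  have fB: "\<bar>f y\<bar> \<le> B" for y using f[of y] by simp
  let ?g = "\<lambda>t x. ((\<integral>y. f y \<partial>P t x) - f x) / t"
  have le: "(\<Sum>x\<in>H. pmf \<pi> x * ?g t x) \<le> 0" if t: "0 < t" for t
  proof -
    have fint: "0 \<le> (\<integral>y. f y \<partial>P t x)" for x
      using f by (simp add: Bochner_Integration.integral_nonneg)
    have fintB: "(\<integral>y. f y \<partial>P t x) \<le> B" for x
    proof -
      have "(\<integral>y. f y \<partial>P t x) \<le> (\<integral>y. B \<partial>P t x)"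
        by (intro integral_mono integrable_measure_pmf_bounded[where B = B])
           (use fB f order.trans[OF f] in auto)
      then show ?thesis by simp
    qed
    have gB: "\<bar>?g t x\<bar> \<le> B / t" for x
      using fint[of x] fintB[of x] f[of x] t
      by (auto simp: abs_le_iff intro!: divide_right_mono)
    have "(\<Sum>x\<in>H. pmf \<pi> x * ?g t x) = (\<integral>x. ?g t x * indicator H x \<partial>\<pi>)"
      by (subst integral_measure_pmf_real[where A = H])
         (use H in \<open>auto simp: indicator_def mult.commute intro!: sum.cong\<close>)
    also have "\<dots> \<le> (\<integral>x. ?g t x \<partial>\<pi>)"
    proof (intro integral_mono integrable_measure_pmf_bounded[where B = "B / t"])
      show "?g t x * indicator H x \<le> ?g t x" for x
        using fint[of x] H(3)[of x] t by (cases "x \<in> H") auto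
      have "0 \<le> B / t" using f t order.trans[OF f] by auto
      then show "\<bar>?g t x * indicator H x\<bar> \<le> B / t" for x
        using gB[of x] by (auto simp: indicator_def)
    qed (use gB in auto)
    also have "\<dots> = 0" by (rule stationary_difference_quotient[OF t fB])
    finally show ?thesis .
  qed
  have "((\<lambda>t. \<Sum>x\<in>H. pmf \<pi> x * ?g t x) \<longlongrightarrow> (\<Sum>x\<in>H. pmf \<pi> x * gen f x)) (at_right 0)"
    by (intro tendsto_sum tendsto_mult tendsto_const difference_quotient_tendsto[OF _ fB])
       (use H in auto)
  then show ?thesis
    by (rule tendsto_upperbound) (use le in \<open>auto simp: eventually_at_filter\<close>)
qed

lemma stationary_generator_bounded:
  assumes rate: "integrable \<pi> exit_rate" and f: "\<And>y. \<bar>f y\<bar> \<le> B"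
  shows "(\<integral>x. gen f x \<partial>\<pi>) = 0"
proof -
  let ?t = "\<lambda>n. 1 / real (Suc n)"
  let ?g = "\<lambda>n x. ((\<integral>y. f y \<partial>P (?t n) x) - f x) / ?t n"
  have lim: "filterlim ?t (at_right 0) sequentially"
    unfolding filterlim_at
    using LIMSEQ_Suc[OF lim_const_over_n[of "1 :: real"]] by auto
  have "(\<lambda>n. \<integral>x. ?g n x \<partial>\<pi>) \<longlonglongrightarrow> (\<integral>x. gen f x \<partial>\<pi>)"
  proof (rule integral_dominated_convergence[where w = "\<lambda>x. 2 * B * exit_rate x"])
    show "AE x in \<pi>. (\<lambda>n. ?g n x) \<longlonglongrightarrow> gen f x"
      using set_pi filterlim_compose[OF difference_quotient_tendsto[of _ f B, OF _ f] lim]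
      by (auto simp: AE_measure_pmf_iff simp del: of_nat_Suc)
    show "AE x in \<pi>. norm (?g n x) \<le> 2 * B * exit_rate x" for n
      using set_pi difference_quotient_bound[of _ "?t n" f B, OF _ _ f]
      by (auto simp: AE_measure_pmf_iff simp del: of_nat_Suc)
  qed (use rate in auto)
  moreover have "(\<integral>x. ?g n x \<partial>\<pi>) = 0" for n
    by (rule stationary_difference_quotient[OF _ f]) simp
  ultimately have "(\<lambda>n. 0) \<longlonglongrightarrow> (\<integral>x. gen f x \<partial>\<pi>)" by simp
  then show ?thesis by (simp add: LIMSEQ_const_iff)
qed

text \<open>
  Clamping \<open>f\<close> to \<open>[-n, n]\<close> does not increase the increments, so \<open>g\<close> dominates the generator
  applied to all the clamped functions.
\<close>

lemma stationary_generator: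
  assumes rate: "integrable \<pi> exit_rate"
    and g: "integrable \<pi> g"
    and bound: "\<And>x. x \<in> S \<Longrightarrow> (\<Sum>y\<in>A x. q x y * \<bar>f y - f x\<bar>) \<le> g x"
  shows "(\<integral>x. gen f x \<partial>\<pi>) = 0"
proof -
  define clamp where "clamp = (\<lambda>n y. max (- real n) (min (real n) (f y)))"
  have cl: "\<bar>clamp n y\<bar> \<le> real n" for n y by (auto simp: clamp_def)
  have lip: "\<bar>clamp n y - clamp n x\<bar> \<le> \<bar>f y - f x\<bar>" for n x y by (auto simp: clamp_def)
  have cl_lim: "(\<lambda>n. clamp n y) \<longlonglongrightarrow> f y" for y
  proof (rule tendsto_eventually)
    obtain N :: nat where "\<bar>f y\<bar> \<le> real N" using real_arch_simple by blast
    then show "eventually (\<lambda>n. clamp n y = f y) sequentially"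
      unfolding eventually_sequentially by (intro exI[of _ N]) (auto simp: clamp_def)
  qed
  have "(\<lambda>n. \<integral>x. gen (clamp n) x \<partial>\<pi>) \<longlonglongrightarrow> (\<integral>x. gen f x \<partial>\<pi>)"
  proof (rule integral_dominated_convergence[where w = g])
    show "AE x in \<pi>. (\<lambda>n. gen (clamp n) x) \<longlonglongrightarrow> gen f x"
      unfolding gen_def by (intro AE_I2 tendsto_sum tendsto_mult tendsto_diff tendsto_const cl_lim)
    have "norm (gen (clamp n) x) \<le> g x" if "x \<in> S" for n x
    proof -
      have "norm (gen (clamp n) x) \<le> (\<Sum>y\<in>A x. \<bar>q x y * (clamp n y - clamp n x)\<bar>)"
        unfolding gen_def by (simp add: sum_abs)
      also have "\<dots> \<le> (\<Sum>y\<in>A x. q x y * \<bar>f y - f x\<bar>)"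
        by (intro sum_mono)
           (use lip q_nonneg[OF that] in \<open>auto simp: abs_mult intro!: mult_left_mono\<close>)
      also note bound[OF that]
      finally show ?thesis .
    qed
    then show "AE x in \<pi>. norm (gen (clamp n) x) \<le> g x" for n
      using set_pi by (auto simp: AE_measure_pmf_iff)
  qed (use g in auto)
  moreover have "(\<integral>x. gen (clamp n) x \<partial>\<pi>) = 0" for n
    by (rule stationary_generator_bounded[OF rate cl])
  ultimately have "(\<lambda>n. 0) \<longlonglongrightarrow> (\<integral>x. gen f x \<partial>\<pi>)" by simp
  then show ?thesis by (simp add: LIMSEQ_const_iff)
qed

end

section \<open>The reward system and its first moments\<close>

definition neighbours :: "nat \<Rightarrow> state \<Rightarrow> state set" where
  "neighbours K = (\<lambda>(Q, c). {(Q(c := Q c + 1), c)} \<union> (\<lambda>k. (Q(k := Q k - 1), c)) ` {1..K}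
     \<union> (\<lambda>c'. (Q, c')) ` {1..K})"

lemma finite_neighbours: "finite (neighbours K w)"
  by (cases w) (simp add: neighbours_def)

lemma neighbours_subset: "w \<in> states K \<Longrightarrow> neighbours K w \<subseteq> states K"
  by (cases w) (auto simp: neighbours_def states_def)

lemma jump_rate_outside:
  assumes "w \<in> states K" "w' \<in> states K" "w' \<notin> neighbours K w"
  shows "jump_rate K lam a b m w w' = 0"
proof -
  obtain Q c Q' c' where w: "w = (Q, c)" "w' = (Q', c')" by (metis surj_pair)
  have up: "\<not> (Q' = Q(c := Q c + 1) \<and> c' = c)" and upd: "Q' \<noteq> Q"
    using assms by (auto simp: w neighbours_def states_def)
  have down: "\<not> (Q' = Q(k := Q k - 1) \<and> c' = c)" if "k \<in> {1..K}" for k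
    using assms that by (auto simp: w neighbours_def)
  from down have down0: "(\<Sum>k=1..K. if Q' = Q(k := Q k - 1) \<and> c' = c then real (Q k) / real m else 0) = 0"
    by (intro sum.neutral ballI if_not_P) blast
  show ?thesis
    unfolding w jump_rate_def prod.case if_not_P[OF up] if_not_P[OF upd] down0 by simp
qed

text \<open>
  Summing over all one-jump targets turns the case distinctions of the rates into the three kinds
  of jumps. Coinciding targets cause no trouble: a departure from an empty coordinate leads back
  to the current state, but has rate \<open>0\<close>.
\<close>

lemma sum_jump_rate:
  assumes w: "(Q, c) \<in> states K"
  shows "(\<Sum>y\<in>neighbours K (Q, c). jump_rate K lam a b m (Q, c) y * h y) =
      lam c * h (Q(c := Q c + 1), c)
      + (\<Sum>k=1..K. real (Q k) / real m * h (Q(k := Q k - 1), c))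
      + (\<Sum>k=1..K. b * choice_prob K a Q k * h (Q, k))"
proof -
  let ?N = "neighbours K (Q, c)"
  have fin: "finite ?N" by (rule finite_neighbours)
  have rate: "jump_rate K lam a b m (Q, c) y * h y =
      (if y = (Q(c := Q c + 1), c) then lam c * h y else 0)
      + (\<Sum>k=1..K. if y = (Q(k := Q k - 1), c) then real (Q k) / real m * h y else 0)
      + (if fst y = Q then b * choice_prob K a Q (snd y) * h y else 0)" for y
  proof -
    obtain Q' c' where y: "y = (Q', c')" by (metis surj_pair)
    have "jump_rate K lam a b m (Q, c) y * h y =
        (if Q' = Q(c := Q c + 1) \<and> c' = c then lam c else 0) * h y
        + (\<Sum>k=1..K. (if Q' = Q(k := Q k - 1) \<and> c' = c then real (Q k) / real m else 0) * h y)
        + (if Q' = Q then b * choice_prob K a Q c' else 0) * h y"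
      by (simp only: y jump_rate_def prod.case distrib_right sum_distrib_right)
    also have "\<dots> = (if y = (Q(c := Q c + 1), c) then lam c * h y else 0)
        + (\<Sum>k=1..K. if y = (Q(k := Q k - 1), c) then real (Q k) / real m * h y else 0)
        + (if fst y = Q then b * choice_prob K a Q (snd y) * h y else 0)"
      by (intro arg_cong2[where f = "(+)"] sum.cong) (auto simp: y)
    finally show ?thesis .
  qed
  have up: "(\<Sum>y\<in>?N. if y = (Q(c := Q c + 1), c) then lam c * h y else 0)
      = lam c * h (Q(c := Q c + 1), c)"
    using fin by (simp add: sum.delta neighbours_def)
  have "(\<Sum>y\<in>?N. \<Sum>k=1..K. if y = (Q(k := Q k - 1), c) then real (Q k) / real m * h y else 0)
      = (\<Sum>k=1..K. \<Sum>y\<in>?N. if y = (Q(k := Q k - 1), c) then real (Q k) / real m * h y else 0)"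
    by (rule sum.swap)
  also have "\<dots> = (\<Sum>k=1..K. real (Q k) / real m * h (Q(k := Q k - 1), c))"
    by (rule sum.cong) (use fin in \<open>auto simp: sum.delta neighbours_def\<close>)
  finally have down: "(\<Sum>y\<in>?N. \<Sum>k=1..K.
      if y = (Q(k := Q k - 1), c) then real (Q k) / real m * h y else 0) = \<dots>" .
  have "(\<Sum>y\<in>?N. if fst y = Q then b * choice_prob K a Q (snd y) * h y else 0)
      = (\<Sum>y\<in>(\<lambda>k. (Q, k)) ` {1..K}. b * choice_prob K a Q (snd y) * h y)"
    by (rule sum.mono_neutral_cong_right)
       (use fin w in \<open>auto simp: neighbours_def states_def\<close>)
  also have "\<dots> = (\<Sum>k=1..K. b * choice_prob K a Q k * h (Q, k))"
    by (subst sum.reindex) (auto simp: inj_on_def)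
  finally have upd: "(\<Sum>y\<in>?N. if fst y = Q then b * choice_prob K a Q (snd y) * h y else 0) = \<dots>" .
  show ?thesis
    unfolding rate sum.distrib up down upd by simp
qed

text \<open>
  One system at its stationary law. The threshold is \<open>al * m\<close>, so that \<open>al\<close> is the threshold on the
  scale of \<open>x = Q / m\<close>; accordingly \<open>S\<close> below is the normalizer of the choice probabilities on that
  scale.
\<close>

locale reward_system =
  fixes K :: nat and lam :: "nat \<Rightarrow> real" and al b :: real and m :: nat
    and P :: "real \<Rightarrow> state \<Rightarrow> state pmf" and \<pi> :: "state pmf"
  assumes K: "1 \<le> K" and lam_pos: "k \<in> {1..K} \<Longrightarrow> 0 < lam k"
    and al: "0 < al" and b: "0 < b" and m: "1 \<le> m"
    and tf: "transition_function (states K) (jump_rate K lam (al * real m) b m) P"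
    and stat: "stationary_distribution (states K) P \<pi>"
begin

definition x :: "nat \<Rightarrow> state \<Rightarrow> real" where "x k w = real (fst w k) / real m"
definition z :: "nat \<Rightarrow> state \<Rightarrow> real" where "z k w = max (x k w) al"
definition S :: "state \<Rightarrow> real" where "S w = (\<Sum>k=1..K. z k w)"
definition share :: "nat \<Rightarrow> state \<Rightarrow> real" where "share k w = z k w / S w"
definition total :: "state \<Rightarrow> real" where "total w = (\<Sum>k=1..K. real (fst w k))"
definition active :: "nat \<Rightarrow> state \<Rightarrow> real" where "active k w = of_bool (snd w = k)"

lemma m_pos: "0 < real m" using m by simp

lemma x_nonneg: "0 \<le> x k w" by (simp add: x_def)
lemma z_ge: "al \<le> z k w" by (simp add: z_def)
lemma z_pos: "0 < z k w" using al z_ge by (rule less_le_trans)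
lemma x_le_z: "x k w \<le> z k w" by (simp add: z_def)

lemma S_ge: "real K * al \<le> S w"
  using sum_bounded_below[of "{1..K}" al "\<lambda>k. z k w"] z_ge by (simp add: S_def)

lemma K_al_pos: "0 < real K * al" using K al by simp

lemma S_pos: "0 < S w" using K_al_pos S_ge by (rule less_le_trans)

lemma z_le_S: "k \<in> {1..K} \<Longrightarrow> z k w \<le> S w"
  unfolding S_def by (rule member_le_sum) (auto intro: less_imp_le z_pos)

lemma share_nonneg: "0 \<le> share k w" using z_pos[of k w] S_pos[of w] by (simp add: share_def)

lemma share_le_1: "k \<in> {1..K} \<Longrightarrow> share k w \<le> 1"
  using z_le_S[of k w] S_pos[of w] by (simp add: share_def)

lemma sum_share: "(\<Sum>k=1..K. share k w) = 1"
  unfolding share_def sum_divide_distrib[symmetric] S_def[symmetric] using S_pos[of w] by simp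

lemma choice_prob_eq: "choice_prob K (al * real m) Q k = share k (Q, c)"
proof -
  have "max (real (Q i)) (al * real m) = real m * z i (Q, c)" for i
    using m_pos by (simp add: z_def x_def max_mult_distrib_left mult.commute)
  then show ?thesis
    using m_pos by (simp add: choice_prob_def share_def S_def sum_distrib_left[symmetric])
qed

lemma active_01: "active k w = 0 \<or> active k w = 1" by (simp add: active_def)
lemma active_nonneg: "0 \<le> active k w" by (simp add: active_def)

lemma total_nonneg: "0 \<le> total w" by (simp add: total_def sum_nonneg)

lemma count_le_total: "k \<in> {1..K} \<Longrightarrow> real (fst w k) \<le> total w"
  unfolding total_def by (rule member_le_sum) auto

lemma x_le_total: "k \<in> {1..K} \<Longrightarrow> x k w \<le> total w"
proof -
  assume "k \<in> {1..K}"
  have "x k w \<le> real (fst w k)" using m by (simp add: x_def divide_le_eq mult_le_cancel_left1)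
  also note count_le_total[OF \<open>k \<in> {1..K}\<close>]
  finally show ?thesis .
qed

definition lamsum :: real where "lamsum = (\<Sum>k=1..K. lam k)"

lemma lam_le_lamsum: "k \<in> {1..K} \<Longrightarrow> lam k \<le> lamsum"
  unfolding lamsum_def by (rule member_le_sum) (use lam_pos in \<open>auto intro: less_imp_le\<close>)

lemma lamsum_nonneg: "0 \<le> lamsum"
  unfolding lamsum_def by (intro sum_nonneg less_imp_le lam_pos)

lemma jump_rate_nonneg:
  assumes "w \<in> states K"
  shows "0 \<le> jump_rate K lam (al * real m) b m w w'"
proof -
  obtain Q c Q' c' where w: "w = (Q, c)" "w' = (Q', c')" by (metis surj_pair)
  have "0 < lam c" using assms by (intro lam_pos) (auto simp: w states_def)
  moreover have "0 \<le> b * choice_prob K (al * real m) Q c'"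
    using b share_nonneg[of c' "(Q, c)"] by (simp add: choice_prob_eq[of _ _ c])
  ultimately show ?thesis
    by (auto simp: w jump_rate_def intro!: add_nonneg_nonneg sum_nonneg)
qed

end

sublocale reward_system \<subseteq> stationary_chain "states K" "jump_rate K lam (al * real m) b m" P \<pi>
    "neighbours K"
  using tf stat finite_neighbours neighbours_subset jump_rate_outside jump_rate_nonneg
  by unfold_locales auto

context reward_system
begin

lemma sum_rates:
  assumes w: "(Q, c) \<in> states K"
  shows "(\<Sum>y\<in>neighbours K (Q, c). jump_rate K lam (al * real m) b m (Q, c) y * h y) =
      lam c * h (Q(c := Q c + 1), c)
      + (\<Sum>k=1..K. x k (Q, c) * h (Q(k := Q k - 1), c))
      + b * (\<Sum>k=1..K. share k (Q, c) * h (Q, k))"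
  unfolding sum_jump_rate[OF w] choice_prob_eq[of _ _ c]
  by (simp add: x_def sum_distrib_left mult.assoc)

lemma finite_truncated_states: "finite {w\<in>states K. total w \<le> real R}"
proof (rule finite_subset)
  have "fst w k \<le> R" if "k \<in> {1..K}" "total w \<le> real R" for k w
    using count_le_total[OF that(1), of w] that(2) by linarith
  then show "{w\<in>states K. total w \<le> real R} \<subseteq>
      {f. \<forall>k. (k \<in> {1..K} \<longrightarrow> f k \<in> {..R}) \<and> (k \<notin> {1..K} \<longrightarrow> f k = 0)} \<times> {1..K}"
    by (fastforce simp: states_def)
  show "finite ({f. \<forall>k. (k \<in> {1..K} \<longrightarrow> f k \<in> {..R}) \<and> (k \<notin> {1..K} \<longrightarrow> f k = (0::nat))} \<times> {1..K})"
    by (intro finite_cartesian_product finite_set_of_finite_funs) auto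
qed

text \<open>
  The test function \<open>max 0 (R - total)\<close> is bounded and has finite support. It drops by at most \<open>1\<close>
  per arrival and, below level \<open>R\<close>, grows by exactly \<open>1\<close> per departure; the bound does not depend
  on \<open>R\<close>.
\<close>

lemma truncated_total_bound:
  "(\<Sum>w\<in>{w\<in>states K. total w \<le> real R}. pmf \<pi> w * total w) \<le> real m * lamsum"
proof -
  let ?H = "{w\<in>states K. total w \<le> real R}"
  have fin: "finite ?H" by (rule finite_truncated_states)
  define f where "f = (\<lambda>w. if w \<in> states K then max 0 (real R - total w) else 0)"
  have drift: "total w / real m - lamsum \<le> gen f w" if wH: "w \<in> ?H" for w
  proof -
    obtain Q c where w: "w = (Q, c)" by (metis surj_pair)
    have S: "(Q, c) \<in> states K" and R: "total (Q, c) \<le> real R" using wH w by auto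
    have c: "c \<in> {1..K}" using S by (simp add: states_def)
    have mem: "(Q(c := Q c + 1), c) \<in> states K" "(Q(k := Q k - 1), c) \<in> states K" for k
      using S by (auto simp: states_def)
    have up: "total (Q(c := Q c + 1), c) = total (Q, c) + 1"
      unfolding total_def using c by (simp add: sum.remove[of _ c])
    have down: "total (Q(k := Q k - 1), c) = total (Q, c) - 1" if "k \<in> {1..K}" "0 < Q k" for k
      unfolding total_def using that by (simp add: sum.remove[of _ k])
    have 1: "lam c * (f (Q(c := Q c + 1), c) - f (Q, c)) \<ge> - lamsum"
    proof -
      have "f (Q(c := Q c + 1), c) - f (Q, c) \<ge> -1"
        using mem S up by (simp add: f_def)
      then have "lam c * (f (Q(c := Q c + 1), c) - f (Q, c)) \<ge> lam c * (-1)"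
        using lam_pos[OF c] by (intro mult_left_mono) auto
      then show ?thesis using lam_le_lamsum[OF c] by linarith
    qed
    have "x k (Q, c) * (f (Q(k := Q k - 1), c) - f (Q, c)) = x k (Q, c)" if k: "k \<in> {1..K}" for k
    proof (cases "Q k = 0")
      case False
      then have "f (Q(k := Q k - 1), c) - f (Q, c) = 1"
        using mem(2)[of k] S down[OF k] R by (simp add: f_def)
      then show ?thesis by simp
    qed (simp add: x_def)
    then have "(\<Sum>k=1..K. x k (Q, c) * (f (Q(k := Q k - 1), c) - f (Q, c)))
        = (\<Sum>k=1..K. x k (Q, c))"
      by (rule sum.cong[OF refl])
    then have 2: "(\<Sum>k=1..K. x k (Q, c) * (f (Q(k := Q k - 1), c) - f (Q, c)))
        = total (Q, c) / real m"
      by (simp add: x_def total_def sum_divide_distrib)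
    have 3: "f (Q, k) - f (Q, c) = 0" if "k \<in> {1..K}" for k
      using S that by (simp add: f_def states_def total_def)
    show ?thesis
      unfolding w gen_def sum_rates[OF S] 2 using 1 3 by simp
  qed
  have "(\<Sum>w\<in>?H. pmf \<pi> w * (total w / real m - lamsum)) \<le> (\<Sum>w\<in>?H. pmf \<pi> w * gen f w)"
    by (intro sum_mono mult_left_mono drift) auto
  also have "\<dots> \<le> 0"
    by (rule stationary_drift_nonpos[where B = "real R"])
       (use fin total_nonneg in \<open>auto simp: f_def\<close>)
  finally have "(\<Sum>w\<in>?H. pmf \<pi> w * total w) / real m \<le> lamsum * (\<Sum>w\<in>?H. pmf \<pi> w)"
    by (simp add: right_diff_distrib sum_subtractf sum_divide_distrib sum_distrib_left mult.commute)
  also have "\<dots> \<le> lamsum * 1"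
    using fin lamsum_nonneg
    by (intro mult_left_mono) (auto simp: measure_measure_pmf_finite[symmetric])
  finally show ?thesis using m_pos by (simp add: field_simps)
qed

lemma integrable_total: "integrable \<pi> total"
proof -
  define f where "f = (\<lambda>R w. total w * indicator {w. total w \<le> real R} w)"
  have fint: "integrable \<pi> (f R)" for R
    by (rule integrable_measure_pmf_bounded[where B = "real R"])
       (use total_nonneg in \<open>auto simp: f_def indicator_def\<close>)
  have mono: "mono (\<lambda>R. f R w)" for w
    using total_nonneg[of w] by (auto simp: f_def mono_def indicator_def)
  have "(\<integral>w. f R w \<partial>\<pi>) \<le> real m * lamsum" for R
  proof -
    have "(\<integral>w. f R w \<partial>\<pi>) = (\<Sum>w\<in>{w\<in>states K. total w \<le> real R}. f R w * pmf \<pi> w)"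
      by (rule integral_measure_pmf_real[OF finite_truncated_states])
         (use set_pi in \<open>auto simp: f_def indicator_def split: if_splits\<close>)
    also have "\<dots> = (\<Sum>w\<in>{w\<in>states K. total w \<le> real R}. pmf \<pi> w * total w)"
      by (rule sum.cong) (auto simp: f_def)
    also note truncated_total_bound
    finally show ?thesis .
  qed
  moreover have "incseq (\<lambda>R. \<integral>w. f R w \<partial>\<pi>)"
    by (intro monoI integral_mono fint) (use mono in \<open>auto simp: mono_def\<close>)
  ultimately obtain L where "(\<lambda>R. \<integral>w. f R w \<partial>\<pi>) \<longlonglongrightarrow> L"
    using incseq_convergent by blast
  moreover have "(\<lambda>R. f R w) \<longlonglongrightarrow> total w" for w
  proof (rule tendsto_eventually)
    obtain N :: nat where "total w \<le> real N" using real_arch_simple by blast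
    then show "eventually (\<lambda>R. f R w = total w) sequentially"
      unfolding eventually_sequentially by (intro exI[of _ N]) (auto simp: f_def)
  qed
  ultimately show ?thesis
    by (intro integrable_monotone_convergence[of \<pi> f total L] fint) (use mono in auto)
qed

lemma integrable_linear_growth:
  fixes f :: "state \<Rightarrow> real"
  assumes "\<And>w. w \<in> states K \<Longrightarrow> \<bar>f w\<bar> \<le> c + d * total w"
  shows "integrable \<pi> f"
  by (rule Bochner_Integration.integrable_bound[of _ "\<lambda>w. c + d * total w"])
     (use assms set_pi integrable_total in
       \<open>auto simp: AE_measure_pmf_iff intro!: order.trans[OF assms]\<close>)

lemma expectation_mono:
  fixes f g :: "state \<Rightarrow> real"
  assumes "integrable \<pi> f" "integrable \<pi> g" "\<And>w. w \<in> states K \<Longrightarrow> f w \<le> g w"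
  shows "(\<integral>w. f w \<partial>\<pi>) \<le> (\<integral>w. g w \<partial>\<pi>)"
  by (rule integral_mono_AE) (use assms set_pi in \<open>auto simp: AE_measure_pmf_iff\<close>)

lemma expectation_cong:
  fixes f g :: "state \<Rightarrow> real"
  assumes "\<And>w. w \<in> states K \<Longrightarrow> f w = g w"
  shows "(\<integral>w. f w \<partial>\<pi>) = (\<integral>w. g w \<partial>\<pi>)"
  by (rule integral_cong_AE) (use assms set_pi in \<open>auto simp: AE_measure_pmf_iff\<close>)

lemma integrable_exit_rate: "integrable \<pi> exit_rate"
proof (rule integrable_linear_growth[where c = "lamsum + b" and d = "real K"])
  fix w assume w: "w \<in> states K"
  obtain Q c where wQ: "w = (Q, c)" by (metis surj_pair)
  have c: "c \<in> {1..K}" using w by (simp add: wQ states_def)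
  have "exit_rate w = lam c + (\<Sum>k=1..K. x k w) + b"
    unfolding exit_rate_def
    using sum_rates[of Q c "\<lambda>_. 1"] w sum_share[of w] by (simp add: wQ)
  moreover have "(\<Sum>k=1..K. x k w) \<le> real K * total w"
    using sum_bounded_above[of "{1..K}" "\<lambda>k. x k w" "total w"] x_le_total by simp
  ultimately show "\<bar>exit_rate w\<bar> \<le> lamsum + b + real K * total w"
    using lam_le_lamsum[OF c] lam_pos[OF c] b sum_nonneg[of "{1..K}" "\<lambda>k. x k w"] x_nonneg
    by auto
qed

section \<open>The balance identity for one reward coordinate\<close>

lemma generator_product:
  assumes w: "w \<in> states K" and k: "k \<in> {1..K}"
  shows "gen (\<lambda>w. h (snd w) * \<psi> (fst w k)) w =
      h (snd w) * (lam k * active k w * (\<psi> (Suc (fst w k)) - \<psi> (fst w k))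
         - x k w * (\<psi> (fst w k) - \<psi> (fst w k - 1)))
      - b * (\<psi> (fst w k) * (h (snd w) - (\<Sum>j=1..K. share j w * h j)))"
proof -
  obtain Q c where wQ: "w = (Q, c)" by (metis surj_pair)
  have S: "(Q, c) \<in> states K" using w wQ by simp
  have up: "lam c * (h c * \<psi> ((Q(c := Q c + 1)) k) - h c * \<psi> (Q k))
      = h c * (lam k * active k w * (\<psi> (Suc (Q k)) - \<psi> (Q k)))"
    by (auto simp: wQ active_def algebra_simps)
  have "(\<Sum>i=1..K. x i (Q, c) * (h c * \<psi> ((Q(i := Q i - 1)) k) - h c * \<psi> (Q k)))
      = (\<Sum>i=1..K. if i = k then - (h c * (x k w * (\<psi> (Q k) - \<psi> (Q k - 1)))) else 0)"
    by (rule sum.cong) (auto simp: wQ algebra_simps)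
  also have "\<dots> = - (h c * (x k w * (\<psi> (Q k) - \<psi> (Q k - 1))))"
    using k by (simp add: sum.delta)
  finally have down: "(\<Sum>i=1..K. x i (Q, c) * (h c * \<psi> ((Q(i := Q i - 1)) k) - h c * \<psi> (Q k)))
      = \<dots>" .
  have "(\<Sum>j=1..K. share j (Q, c) * (h j * \<psi> (Q k) - h c * \<psi> (Q k)))
      = \<psi> (Q k) * ((\<Sum>j=1..K. share j w * h j) - h c * (\<Sum>j=1..K. share j w))"
    by (simp add: wQ sum_distrib_left right_diff_distrib sum_subtractf mult.assoc
        mult.left_commute mult.commute)
  then have upd: "(\<Sum>j=1..K. share j (Q, c) * (h j * \<psi> (Q k) - h c * \<psi> (Q k)))
      = - (\<psi> (Q k) * (h c - (\<Sum>j=1..K. share j w * h j)))"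
    unfolding sum_share by (simp add: algebra_simps)
  have "gen (\<lambda>w. h (snd w) * \<psi> (fst w k)) w
      = lam c * (h c * \<psi> ((Q(c := Q c + 1)) k) - h c * \<psi> (Q k))
        + (\<Sum>i=1..K. x i (Q, c) * (h c * \<psi> ((Q(i := Q i - 1)) k) - h c * \<psi> (Q k)))
        + b * (\<Sum>j=1..K. share j (Q, c) * (h j * \<psi> (Q k) - h c * \<psi> (Q k)))"
    unfolding wQ gen_def sum_rates[OF S] by simp
  also have "\<dots> = h c * (lam k * active k w * (\<psi> (Suc (Q k)) - \<psi> (Q k)))
      - h c * (x k w * (\<psi> (Q k) - \<psi> (Q k - 1)))
      - b * (\<psi> (Q k) * (h c - (\<Sum>j=1..K. share j w * h j)))"
    unfolding up down upd by simp
  finally show ?thesis by (simp add: wQ right_diff_distrib)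
qed

lemma bounded_increments:
  fixes \<psi> :: "nat \<Rightarrow> real"
  assumes "\<And>n. \<bar>\<psi> (Suc n) - \<psi> n\<bar> \<le> B"
  shows "\<bar>\<psi> n\<bar> \<le> \<bar>\<psi> 0\<bar> + B * real n"
proof (induction n)
  case (Suc n)
  then show ?case using assms[of n] by (simp add: algebra_simps)
qed simp

text \<open>
  The identity \<open>E (L f) = 0\<close> for \<open>f = h(c) \<psi>(Q\<^sub>k)\<close>. Bounded increments of \<open>\<psi>\<close> make all terms grow at
  most linearly in the total reward, which is integrable.
\<close>

lemma balance_product:
  fixes h :: "nat \<Rightarrow> real" and \<psi> :: "nat \<Rightarrow> real"
  assumes k: "k \<in> {1..K}" and inc: "\<And>n. \<bar>\<psi> (Suc n) - \<psi> n\<bar> \<le> B"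
  shows "(\<integral>w. h (snd w) * (lam k * active k w * (\<psi> (Suc (fst w k)) - \<psi> (fst w k))
         - x k w * (\<psi> (fst w k) - \<psi> (fst w k - 1))) \<partial>\<pi>)
      = b * (\<integral>w. \<psi> (fst w k) * (h (snd w) - (\<Sum>j=1..K. share j w * h j)) \<partial>\<pi>)" (is "?L = b * ?R")
    and "integrable \<pi> (\<lambda>w. h (snd w) * (lam k * active k w * (\<psi> (Suc (fst w k)) - \<psi> (fst w k))
         - x k w * (\<psi> (fst w k) - \<psi> (fst w k - 1))))" (is "integrable \<pi> ?l")
    and "integrable \<pi> (\<lambda>w. \<psi> (fst w k) * (h (snd w) - (\<Sum>j=1..K. share j w * h j)))"
      (is "integrable \<pi> ?r")
proof -
  let ?f = "\<lambda>w. h (snd w) * \<psi> (fst w k)"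
  define H where "H = (\<Sum>j=1..K. \<bar>h j\<bar>)"
  have H: "\<bar>h j\<bar> \<le> H" if "j \<in> {1..K}" for j
    unfolding H_def using that by (intro member_le_sum) auto
  have H0: "0 \<le> H" by (simp add: H_def)
  have B0: "0 \<le> B" using inc[of 0] by linarith
  have \<psi>: "\<bar>\<psi> (fst w k)\<bar> \<le> \<bar>\<psi> 0\<bar> + B * total w" for w
    using bounded_increments[of \<psi> B "fst w k", OF inc]
      mult_left_mono[OF count_le_total[OF k, of w] B0] by linarith
  have inc': "\<bar>\<psi> (n - 1) - \<psi> n\<bar> \<le> B" for n
    using inc[of "n - 1"] B0 by (cases n) auto
  have lk: "0 < lam k" by (rule lam_pos[OF k])
  let ?c = "lamsum * (H * B) + b * (2 * H * \<bar>\<psi> 0\<bar>)" and ?d = "H * B + b * (2 * H * B)"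
  have rates: "(\<Sum>y\<in>neighbours K w. jump_rate K lam (al * real m) b m w y * \<bar>?f y - ?f w\<bar>)
      \<le> ?c + ?d * total w" if w: "w \<in> states K" for w
  proof -
    obtain Q c where wQ: "w = (Q, c)" by (metis surj_pair)
    have S: "(Q, c) \<in> states K" using w wQ by simp
    have c: "c \<in> {1..K}" using S by (simp add: states_def)
    have up: "lam c * \<bar>h c * \<psi> ((Q(c := Q c + 1)) k) - h c * \<psi> (Q k)\<bar> \<le> lamsum * (H * B)"
    proof (intro mult_mono lam_le_lamsum c lamsum_nonneg)
      have "\<bar>h c * \<psi> ((Q(c := Q c + 1)) k) - h c * \<psi> (Q k)\<bar>
          = \<bar>h c\<bar> * \<bar>\<psi> ((Q(c := Q c + 1)) k) - \<psi> (Q k)\<bar>"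
        by (simp add: abs_mult right_diff_distrib[symmetric])
      also have "\<dots> \<le> H * B"
        by (intro mult_mono H c H0) (use inc B0 in auto)
      finally show "\<bar>h c * \<psi> ((Q(c := Q c + 1)) k) - h c * \<psi> (Q k)\<bar> \<le> H * B" .
    qed simp
    have "(\<Sum>i=1..K. x i (Q, c) * \<bar>h c * \<psi> ((Q(i := Q i - 1)) k) - h c * \<psi> (Q k)\<bar>)
        = (\<Sum>i=1..K. if i = k then x k w * (\<bar>h c\<bar> * \<bar>\<psi> (Q k - 1) - \<psi> (Q k)\<bar>) else 0)"
      by (rule sum.cong) (auto simp: wQ abs_mult[symmetric] right_diff_distrib)
    also have "\<dots> = x k w * (\<bar>h c\<bar> * \<bar>\<psi> (Q k - 1) - \<psi> (Q k)\<bar>)"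
      using k by (simp add: sum.delta)
    also have "\<dots> \<le> total w * (H * B)"
      by (intro mult_mono x_le_total k H c H0 inc' total_nonneg mult_nonneg_nonneg B0) auto
    finally have down:
      "(\<Sum>i=1..K. x i (Q, c) * \<bar>h c * \<psi> ((Q(i := Q i - 1)) k) - h c * \<psi> (Q k)\<bar>) \<le> \<dots>" .
    have "(\<Sum>j=1..K. share j (Q, c) * \<bar>h j * \<psi> (Q k) - h c * \<psi> (Q k)\<bar>)
        \<le> (\<Sum>j=1..K. share j (Q, c) * (2 * H * (\<bar>\<psi> 0\<bar> + B * total w)))"
    proof (intro sum_mono mult_left_mono share_nonneg)
      fix j assume j: "j \<in> {1..K}"
      have "\<bar>h j * \<psi> (Q k) - h c * \<psi> (Q k)\<bar> = \<bar>h j - h c\<bar> * \<bar>\<psi> (Q k)\<bar>"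
        by (simp add: abs_mult[symmetric] left_diff_distrib)
      also have "\<dots> \<le> (2 * H) * (\<bar>\<psi> 0\<bar> + B * total w)"
        using H[OF j] H[OF c] \<psi>[of w] H0 by (intro mult_mono) (auto simp: wQ)
      finally show "\<bar>h j * \<psi> (Q k) - h c * \<psi> (Q k)\<bar> \<le> 2 * H * (\<bar>\<psi> 0\<bar> + B * total w)" .
    qed
    also have "\<dots> = 2 * H * (\<bar>\<psi> 0\<bar> + B * total w)"
      unfolding sum_distrib_right[symmetric] sum_share by simp
    finally have upd: "b * (\<Sum>j=1..K. share j (Q, c) * \<bar>h j * \<psi> (Q k) - h c * \<psi> (Q k)\<bar>)
        \<le> b * (2 * H * (\<bar>\<psi> 0\<bar> + B * total w))"
      using b by (intro mult_left_mono) auto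
    have "(\<Sum>y\<in>neighbours K w. jump_rate K lam (al * real m) b m w y * \<bar>?f y - ?f w\<bar>)
        = lam c * \<bar>h c * \<psi> ((Q(c := Q c + 1)) k) - h c * \<psi> (Q k)\<bar>
        + (\<Sum>i=1..K. x i (Q, c) * \<bar>h c * \<psi> ((Q(i := Q i - 1)) k) - h c * \<psi> (Q k)\<bar>)
        + b * (\<Sum>j=1..K. share j (Q, c) * \<bar>h j * \<psi> (Q k) - h c * \<psi> (Q k)\<bar>)"
      unfolding wQ sum_rates[OF S] by simp
    also have "\<dots> \<le> lamsum * (H * B) + total w * (H * B) + b * (2 * H * (\<bar>\<psi> 0\<bar> + B * total w))"
      by (intro add_mono up down upd)
    finally show ?thesis by (simp add: algebra_simps)
  qed
  have g: "integrable \<pi> (\<lambda>w. ?c + ?d * total w)" using integrable_total by simp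
  have stationary: "(\<integral>w. gen ?f w \<partial>\<pi>) = 0"
    by (rule stationary_generator[OF integrable_exit_rate g rates])
  show r: "integrable \<pi> ?r"
  proof (rule integrable_linear_growth[where c = "2 * H * \<bar>\<psi> 0\<bar>" and d = "2 * H * B"])
    fix w assume w: "w \<in> states K"
    have c: "snd w \<in> {1..K}" using w by (auto simp: states_def)
    have "\<bar>\<Sum>j=1..K. share j w * h j\<bar> \<le> (\<Sum>j=1..K. \<bar>share j w * h j\<bar>)" by (rule sum_abs)
    also have "\<dots> \<le> (\<Sum>j=1..K. share j w * H)"
      unfolding abs_mult abs_of_nonneg[OF share_nonneg] by (intro sum_mono mult_left_mono H share_nonneg)
    also have "\<dots> = H" unfolding sum_distrib_right[symmetric] sum_share by simp
    finally have "\<bar>h (snd w) - (\<Sum>j=1..K. share j w * h j)\<bar> \<le> 2 * H" using H[OF c] by linarith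
    then have "\<bar>?r w\<bar> \<le> (\<bar>\<psi> 0\<bar> + B * total w) * (2 * H)"
      unfolding abs_mult using \<psi>[of w] by (intro mult_mono) auto
    then show "\<bar>?r w\<bar> \<le> 2 * H * \<bar>\<psi> 0\<bar> + 2 * H * B * total w" by (simp add: algebra_simps)
  qed
  show l: "integrable \<pi> ?l"
  proof (rule integrable_linear_growth[where c = "H * (lam k * B)" and d = "H * B"])
    fix w assume w: "w \<in> states K"
    have c: "snd w \<in> {1..K}" using w by (auto simp: states_def)
    have 1: "\<bar>lam k * active k w * (\<psi> (Suc (fst w k)) - \<psi> (fst w k))\<bar> \<le> lam k * B"
      using lk inc[of "fst w k"] active_01[of k w] B0 by (auto simp: abs_mult)
    have "\<bar>x k w * (\<psi> (fst w k) - \<psi> (fst w k - 1))\<bar> \<le> total w * B"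
      unfolding abs_mult using x_nonneg[of k w] x_le_total[OF k, of w] inc'[of "fst w k"] total_nonneg
      by (intro mult_mono) auto
    with 1 have "\<bar>lam k * active k w * (\<psi> (Suc (fst w k)) - \<psi> (fst w k))
        - x k w * (\<psi> (fst w k) - \<psi> (fst w k - 1))\<bar> \<le> lam k * B + total w * B" by linarith
    then have "\<bar>?l w\<bar> \<le> H * (lam k * B + total w * B)"
      unfolding abs_mult[of "h (snd w)"] by (intro mult_mono H c H0) auto
    then show "\<bar>?l w\<bar> \<le> H * (lam k * B) + H * B * total w" by (simp add: algebra_simps)
  qed
  have "0 = (\<integral>w. ?l w - b * ?r w \<partial>\<pi>)"
    unfolding stationary[symmetric] by (rule expectation_cong) (rule generator_product[OF _ k])
  also have "\<dots> = ?L - b * ?R" using l r by simp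
  finally show "?L = b * ?R" by simp
qed

end

lemma abs_inverse_diff:
  fixes s t :: real
  assumes "0 < s" "0 < t"
  shows "\<bar>1 / s - 1 / t\<bar> = \<bar>s - t\<bar> / (s * t)"
proof -
  have "1 / s - 1 / t = (t - s) / (s * t)" using assms by (simp add: field_simps)
  then show ?thesis using assms by (simp add: abs_minus_commute)
qed

text \<open>
  Turns a bound on \<open>E ((S - l)\<^sup>2 / S)\<close> into one on \<open>E \<bar>S - l\<bar>\<close>; the inequality is
  \<open>2 u v \<le> u\<^sup>2 + v\<^sup>2\<close> with \<open>u = e s\<close> and \<open>v = \<bar>s - l\<bar>\<close>.
\<close>

lemma abs_diff_le_weighted:
  fixes s l e :: real
  assumes "0 < s" "0 < e"
  shows "\<bar>s - l\<bar> \<le> e / 2 * s + (s - l)\<^sup>2 / s / (2 * e)"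
proof -
  have "0 \<le> (e * s - \<bar>s - l\<bar>)\<^sup>2" by simp
  then have "2 * (e * s) * \<bar>s - l\<bar> \<le> (e * s)\<^sup>2 + (s - l)\<^sup>2"
    by (simp add: power2_diff)
  then show ?thesis using assms by (simp add: field_simps power2_eq_square)
qed

context reward_system
begin

abbreviation E :: "(state \<Rightarrow> real) \<Rightarrow> real" where
  "E f \<equiv> measure_pmf.expectation \<pi> f"

lemma snd_states: "w \<in> states K \<Longrightarrow> snd w \<in> {1..K}"
  by (auto simp: states_def)

lemma integrable_bounded:
  fixes f :: "state \<Rightarrow> real"
  shows "(\<And>w. w \<in> states K \<Longrightarrow> \<bar>f w\<bar> \<le> c) \<Longrightarrow> integrable \<pi> f"
  by (rule integrable_linear_growth[where c = c and d = 0]) simp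

lemma integrable_x_dominated:
  fixes f :: "state \<Rightarrow> real"
  assumes "k \<in> {1..K}" "\<And>w. w \<in> states K \<Longrightarrow> \<bar>f w\<bar> \<le> c * x k w + d" "0 \<le> c"
  shows "integrable \<pi> f"
proof (rule integrable_linear_growth[where c = d and d = c])
  fix w assume "w \<in> states K"
  then show "\<bar>f w\<bar> \<le> d + c * total w"
    using assms(2)[of w] mult_left_mono[OF x_le_total[OF assms(1), of w] assms(3)] by linarith
qed

lemma integrable_active: "integrable \<pi> (active k)"
  by (rule integrable_bounded[where c = 1]) (simp add: active_def)

lemma integrable_share: "k \<in> {1..K} \<Longrightarrow> integrable \<pi> (share k)"
  by (rule integrable_bounded[where c = 1]) (simp add: share_nonneg share_le_1)

lemma integrable_x:
  assumes "k \<in> {1..K}"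
  shows "integrable \<pi> (x k)"
  by (rule integrable_x_dominated[OF assms, where c = 1 and d = 0]) (simp_all add: x_nonneg)

lemma sum_active: "w \<in> states K \<Longrightarrow> (\<Sum>k=1..K. active k w) = 1"
  using snd_states[of w] by (simp add: active_def of_bool_def sum.delta)

lemma E_active: "E (active k) = measure_pmf.prob \<pi> {w. snd w = k}"
proof -
  have "active k = indicator {w. snd w = k}" by (auto simp: active_def indicator_def)
  then show ?thesis by simp
qed

lemma sum_E_active: "(\<Sum>k=1..K. E (active k)) = 1"
proof -
  have "(\<Sum>k=1..K. E (active k)) = E (\<lambda>w. \<Sum>k=1..K. active k w)"
    by (rule Bochner_Integration.integral_sum[symmetric]) (rule integrable_active)
  also have "\<dots> = E (\<lambda>w. 1)" by (rule expectation_cong) (rule sum_active)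
  finally show ?thesis by simp
qed

lemma E_active_bounds: "0 \<le> E (active k)" "E (active k) \<le> 1"
  unfolding E_active by simp_all

lemma sum_share_of_bool:
  assumes "k \<in> {1..K}"
  shows "(\<Sum>j=1..K. share j w * of_bool (j = k)) = share k w"
  using assms by (simp add: sum.delta of_bool_def if_distrib cong: if_cong)

text \<open>
  The law of the action is invariant under an update: the balance identity with \<open>\<psi> = 1\<close>.
\<close>

lemma action_share:
  assumes k: "k \<in> {1..K}"
  shows "E (active k) = E (share k)"
proof -
  note eq = sum_share_of_bool[OF k]
  have "b * E (\<lambda>w. 1 * (of_bool (snd w = k) - (\<Sum>j=1..K. share j w * of_bool (j = k)))) = 0"
    using balance_product(1)[of k "\<lambda>_. 1" 0 "\<lambda>c. of_bool (c = k)"] k by simp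
  then have "E (\<lambda>w. active k w - share k w) = 0"
    unfolding eq using b by (simp add: active_def)
  then show ?thesis using integrable_active integrable_share[OF k] by simp
qed

lemma mean_x:
  assumes k: "k \<in> {1..K}"
  shows "E (x k) = lam k * E (active k)"
proof -
  have "E (\<lambda>w. 1 * (lam k * active k w * (real (Suc (fst w k)) - real (fst w k))
         - x k w * (real (fst w k) - real (fst w k - 1))))
      = b * E (\<lambda>w. real (fst w k) * (1 - (\<Sum>j=1..K. share j w * 1)))"
    by (rule balance_product(1)[OF k, where B = 1]) simp
  also have "\<dots> = 0" by (simp only: mult_1_right sum_share) simp
  also have "(\<lambda>w. 1 * (lam k * active k w * (real (Suc (fst w k)) - real (fst w k))
         - x k w * (real (fst w k) - real (fst w k - 1)))) = (\<lambda>w. lam k * active k w - x k w)"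
    by (auto simp: fun_eq_iff x_def of_nat_diff)
  finally show ?thesis using integrable_active integrable_x[OF k] by simp
qed

lemma mean_x_bounds:
  assumes k: "k \<in> {1..K}"
  shows "0 \<le> E (x k)" "E (x k) \<le> lam k"
  unfolding mean_x[OF k] using lam_pos[OF k] E_active_bounds[of k] by (simp_all add: mult_left_le)

text \<open>
  The discrete antiderivative \<open>\<psi>\<close> of \<open>\<phi>\<close> makes the arrival term of the balance identity exactly
  \<open>\<phi>(x\<^sub>k)\<close>. The departure term is \<open>\<phi>\<close> one step of size \<open>1 / m\<close> lower, which costs the error
  \<open>L / m\<close> times \<open>E x\<^sub>k\<close>.
\<close>

lemma tested_balance:
  fixes \<phi> :: "real \<Rightarrow> real" and h :: "nat \<Rightarrow> real"
  assumes k: "k \<in> {1..K}"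
    and B: "\<And>s. 0 \<le> s \<Longrightarrow> \<bar>\<phi> s\<bar> \<le> B"
    and L: "\<And>s t. 0 \<le> s \<Longrightarrow> 0 \<le> t \<Longrightarrow> \<bar>\<phi> s - \<phi> t\<bar> \<le> L * \<bar>s - t\<bar>"
    and h: "\<And>j. 0 \<le> h j" "\<And>j. h j \<le> 1"
  defines "\<psi> \<equiv> \<lambda>n. \<Sum>i<n. \<phi> (real i / real m)"
  shows "\<bar>E (\<lambda>w. h (snd w) * (lam k * active k w * \<phi> (x k w) - x k w * \<phi> (x k w)))
      - b * E (\<lambda>w. \<psi> (fst w k) * (h (snd w) - (\<Sum>j=1..K. share j w * h j)))\<bar> \<le> L * lam k / real m"
proof -
  have B0: "0 \<le> B" using B[of 0] by linarith
  have L0: "0 \<le> L" using L[of 0 1] by simp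
  have inc: "\<psi> (Suc n) - \<psi> n = \<phi> (real n / real m)" for n by (simp add: \<psi>_def)
  have incB: "\<bar>\<psi> (Suc n) - \<psi> n\<bar> \<le> B" for n
    unfolding inc by (rule B) simp
  let ?x' = "\<lambda>w. real (fst w k - 1) / real m"
  let ?l = "\<lambda>w. h (snd w) * (lam k * active k w * (\<psi> (Suc (fst w k)) - \<psi> (fst w k))
         - x k w * (\<psi> (fst w k) - \<psi> (fst w k - 1)))"
  let ?a = "\<lambda>w. h (snd w) * (lam k * active k w * \<phi> (x k w) - x k w * \<phi> (x k w))"
  have down: "x k w * (\<psi> (fst w k) - \<psi> (fst w k - 1)) = x k w * \<phi> (?x' w)" for w
    using inc[of "fst w k - 1"] by (cases "fst w k") (auto simp: x_def)
  have l: "?l w = h (snd w) * (lam k * active k w * \<phi> (x k w) - x k w * \<phi> (?x' w))" for w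
    unfolding down inc by (simp add: x_def)
  \<comment> \<open>truncated subtraction is harmless: for \<open>Q\<^sub>k = 0\<close> both arguments are \<open>0\<close>\<close>
  have close: "\<bar>\<phi> (x k w) - \<phi> (?x' w)\<bar> \<le> L / real m" for w
  proof -
    have "\<bar>x k w - ?x' w\<bar> \<le> 1 / real m"
      using m_pos by (cases "fst w k") (auto simp: x_def diff_divide_distrib[symmetric])
    then have "L * \<bar>x k w - ?x' w\<bar> \<le> L * (1 / real m)"
      by (rule mult_left_mono) (rule L0)
    moreover have "\<bar>\<phi> (x k w) - \<phi> (?x' w)\<bar> \<le> L * \<bar>x k w - ?x' w\<bar>"
      by (rule L) (simp_all add: x_nonneg)
    ultimately show ?thesis by simp
  qed
  have diff: "\<bar>?a w - ?l w\<bar> \<le> L / real m * x k w" for w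
  proof -
    have "?a w - ?l w = - (h (snd w) * x k w * (\<phi> (x k w) - \<phi> (?x' w)))"
      unfolding l by (simp add: algebra_simps)
    then have "\<bar>?a w - ?l w\<bar> = h (snd w) * x k w * \<bar>\<phi> (x k w) - \<phi> (?x' w)\<bar>"
      using h x_nonneg by (simp add: abs_mult)
    also have "\<dots> \<le> (1 * x k w) * (L / real m)"
      using h x_nonneg close L0 by (intro mult_mono) auto
    finally show ?thesis by (simp add: mult.commute)
  qed
  note bal = balance_product[of k \<psi> B h, OF k incB]
  have inta: "integrable \<pi> ?a"
  proof -
    have "integrable \<pi> (\<lambda>w. ?a w - ?l w)"
      by (rule integrable_x_dominated[OF k, where c = "L / real m" and d = 0])
         (use diff L0 in auto)
    from Bochner_Integration.integrable_add[OF this bal(2)] show ?thesis by simp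
  qed
  have "\<bar>E ?a - E ?l\<bar> = \<bar>E (\<lambda>w. ?a w - ?l w)\<bar>"
    using inta bal(2) by simp
  also have "\<dots> \<le> E (\<lambda>w. \<bar>?a w - ?l w\<bar>)" by (rule integral_abs_bound)
  also have "\<dots> \<le> E (\<lambda>w. L / real m * x k w)"
    by (rule expectation_mono) (use inta bal(2) integrable_x[OF k] diff in auto)
  also have "\<dots> = L / real m * E (x k)" by simp
  also have "\<dots> \<le> L / real m * lam k"
    using mean_x_bounds[OF k] L0 by (intro mult_left_mono) auto
  finally show ?thesis unfolding bal(1) by simp
qed

text \<open>
  With \<open>h = 1\<close> updates are invisible, so this holds in both regimes.
\<close>

lemma tested_mean:
  fixes \<phi> :: "real \<Rightarrow> real"
  assumes k: "k \<in> {1..K}"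
    and B: "\<And>s. 0 \<le> s \<Longrightarrow> \<bar>\<phi> s\<bar> \<le> B"
    and L: "\<And>s t. 0 \<le> s \<Longrightarrow> 0 \<le> t \<Longrightarrow> \<bar>\<phi> s - \<phi> t\<bar> \<le> L * \<bar>s - t\<bar>"
  shows "\<bar>lam k * E (\<lambda>w. active k w * \<phi> (x k w)) - E (\<lambda>w. x k w * \<phi> (x k w))\<bar> \<le> L * lam k / real m"
proof -
  have phi: "\<bar>\<phi> (x k w)\<bar> \<le> B" for w by (rule B) (rule x_nonneg)
  have i1: "integrable \<pi> (\<lambda>w. active k w * \<phi> (x k w))"
    by (rule integrable_bounded[where c = B])
       (use phi active_01 order.trans[OF abs_ge_zero phi] in \<open>auto simp: abs_mult active_def\<close>)
  have i2: "integrable \<pi> (\<lambda>w. x k w * \<phi> (x k w))"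
    by (rule integrable_x_dominated[OF k, where c = B and d = 0])
       (use phi x_nonneg order.trans[OF abs_ge_zero phi] in
         \<open>auto simp: abs_mult mult.commute[of B] intro!: mult_left_mono\<close>)
  have "\<bar>E (\<lambda>w. lam k * active k w * \<phi> (x k w) - x k w * \<phi> (x k w))\<bar> \<le> L * lam k / real m"
    using tested_balance[OF k B L, of "\<lambda>_. 1"] by (simp add: sum_share[unfolded One_nat_def])
  then show ?thesis using i1 i2 by (simp add: mult.assoc)
qed

text \<open>
  The estimate for rare updates: for small \<open>m b\<close>, the coordinate \<open>x\<^sub>k\<close> is in equilibrium at \<open>\<lambda>\<^sub>k\<close> on
  the event that \<open>k\<close> is active.
\<close>

lemma tested_active:
  fixes \<phi> :: "real \<Rightarrow> real"
  assumes k: "k \<in> {1..K}"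
    and B: "\<And>s. 0 \<le> s \<Longrightarrow> \<bar>\<phi> s\<bar> \<le> B"
    and L: "\<And>s t. 0 \<le> s \<Longrightarrow> 0 \<le> t \<Longrightarrow> \<bar>\<phi> s - \<phi> t\<bar> \<le> L * \<bar>s - t\<bar>"
  shows "\<bar>E (\<lambda>w. active k w * (\<phi> (x k w) * (lam k - x k w)))\<bar>
      \<le> L * lam k / real m + real m * b * B * lam k"
proof -
  define \<psi> where "\<psi> = (\<lambda>n. \<Sum>i<n. \<phi> (real i / real m))"
  have B0: "0 \<le> B" using B[of 0] by linarith
  have psi: "\<bar>\<psi> (fst w k)\<bar> \<le> B * real m * x k w" for w
  proof -
    have "\<bar>\<psi> (Suc n) - \<psi> n\<bar> \<le> B" for n unfolding \<psi>_def by (simp add: B)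
    from bounded_increments[of \<psi> B "fst w k", OF this] show ?thesis
      using m_pos by (simp add: x_def \<psi>_def)
  qed
  note eq = sum_share_of_bool[OF k]
  let ?r = "\<lambda>w. \<psi> (fst w k) * (active k w - share k w)"
  have rb: "\<bar>?r w\<bar> \<le> B * real m * x k w" for w
  proof -
    have "\<bar>active k w - share k w\<bar> \<le> 1"
      using active_01[of k w] share_nonneg[of k w] share_le_1[OF k, of w] by auto
    then have "\<bar>?r w\<bar> \<le> (B * real m * x k w) * 1"
      unfolding abs_mult using psi[of w] order.trans[OF abs_ge_zero psi[of w]]
      by (intro mult_mono) auto
    then show ?thesis by simp
  qed
  have intr: "integrable \<pi> ?r"
    by (rule integrable_x_dominated[OF k, where c = "B * real m" and d = 0]) (use rb B0 in auto)
  have "\<bar>E ?r\<bar> \<le> E (\<lambda>w. \<bar>?r w\<bar>)" by (rule integral_abs_bound)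
  also have "\<dots> \<le> E (\<lambda>w. B * real m * x k w)"
    by (rule expectation_mono) (use intr integrable_x[OF k] rb in auto)
  also have "\<dots> = B * real m * E (x k)" by simp
  also have "\<dots> \<le> B * real m * lam k"
    using mean_x_bounds[OF k] B0 by (intro mult_left_mono) auto
  finally have "b * \<bar>E ?r\<bar> \<le> b * (B * real m * lam k)"
    using b by (intro mult_left_mono) auto
  then have R: "\<bar>b * E ?r\<bar> \<le> real m * b * B * lam k"
    using b by (simp add: abs_mult algebra_simps)
  have active_idem: "active k w * (lam k * active k w * \<phi> (x k w) - x k w * \<phi> (x k w))
      = active k w * (\<phi> (x k w) * (lam k - x k w))" for w
    using active_01[of k w] by (auto simp: algebra_simps)
  have "\<bar>E (\<lambda>w. active k w * (lam k * active k w * \<phi> (x k w) - x k w * \<phi> (x k w))) - b * E ?r\<bar>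
      \<le> L * lam k / real m"
    using tested_balance[OF k B L, of "\<lambda>c. of_bool (c = k)"]
    unfolding eq active_def[symmetric] by (simp add: \<psi>_def)
  then show ?thesis using R unfolding active_idem by linarith
qed

text \<open>
  The estimate for frequent updates: for large \<open>m b\<close>, the indicator that \<open>k\<close> is active can be
  replaced by the choice probability. On the time scale \<open>m\<close> the rewards move at speed of order
  \<open>1\<close>, whereas the action is redrawn at rate \<open>m b\<close>.
\<close>

lemma tested_choice:
  fixes \<phi> :: "real \<Rightarrow> real"
  assumes k: "k \<in> {1..K}"
    and L: "\<And>s t. 0 \<le> s \<Longrightarrow> 0 \<le> t \<Longrightarrow> \<bar>\<phi> s - \<phi> t\<bar> \<le> L * \<bar>s - t\<bar>"
  shows "\<bar>E (\<lambda>w. \<phi> (x k w) * (active k w - share k w))\<bar> \<le> 2 * L * lam k / (real m * b)"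
proof -
  define \<psi> where "\<psi> = (\<lambda>n. \<phi> (real n / real m))"
  have L0: "0 \<le> L" using L[of 0 1] by simp
  have inc: "\<bar>\<psi> (Suc n) - \<psi> n\<bar> \<le> L / real m" for n
    using L[of "real (Suc n) / real m" "real n / real m"] m_pos
    by (simp add: \<psi>_def diff_divide_distrib[symmetric])
  have inc': "\<bar>\<psi> n - \<psi> (n - 1)\<bar> \<le> L / real m" for n
    using inc[of "n - 1"] L0 by (cases n) auto
  note eq = sum_share_of_bool[OF k]
  let ?l = "\<lambda>w. active k w * (lam k * active k w * (\<psi> (Suc (fst w k)) - \<psi> (fst w k))
         - x k w * (\<psi> (fst w k) - \<psi> (fst w k - 1)))"
  note bal = balance_product[of k \<psi> "L / real m" "\<lambda>c. of_bool (c = k)", OF k inc, unfolded eq active_def[symmetric]]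
  have lb: "\<bar>?l w\<bar> \<le> L / real m * (lam k + x k w)" for w
  proof -
    have 1: "\<bar>lam k * active k w * (\<psi> (Suc (fst w k)) - \<psi> (fst w k))\<bar> \<le> lam k * (L / real m)"
      using mult_left_mono[OF inc[of "fst w k"], of "lam k"] lam_pos[OF k] active_01[of k w] L0 m_pos
      by (auto simp: abs_mult)
    have 2: "\<bar>x k w * (\<psi> (fst w k) - \<psi> (fst w k - 1))\<bar> \<le> x k w * (L / real m)"
      using mult_left_mono[OF inc'[of "fst w k"] x_nonneg[of k w]] x_nonneg[of k w]
      by (simp add: abs_mult)
    have 3: "\<bar>?l w\<bar> \<le> \<bar>lam k * active k w * (\<psi> (Suc (fst w k)) - \<psi> (fst w k))
         - x k w * (\<psi> (fst w k) - \<psi> (fst w k - 1))\<bar>"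
      using active_01[of k w] by auto
    have "\<bar>?l w\<bar> \<le> lam k * (L / real m) + x k w * (L / real m)" using 1 2 3 by linarith
    then show ?thesis by (simp add: algebra_simps)
  qed
  have "b * \<bar>E (\<lambda>w. \<psi> (fst w k) * (active k w - share k w))\<bar> = \<bar>E ?l\<bar>"
    using b unfolding bal(1) by (simp add: abs_mult)
  also have "\<dots> \<le> E (\<lambda>w. \<bar>?l w\<bar>)" by (rule integral_abs_bound)
  also have "\<dots> \<le> E (\<lambda>w. L / real m * (lam k + x k w))"
    by (rule expectation_mono) (use bal(2) integrable_x[OF k] lb in auto)
  also have "\<dots> = L / real m * (lam k + E (x k))"
    using integrable_x[OF k] by simp
  also have "\<dots> \<le> L / real m * (2 * lam k)"
    using mean_x_bounds[OF k] L0 by (intro mult_left_mono) auto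
  finally have "b * \<bar>E (\<lambda>w. \<phi> (x k w) * (active k w - share k w))\<bar> \<le> 2 * L * lam k / real m"
    by (simp add: \<psi>_def x_def mult.commute mult.left_commute)
  then show ?thesis using b m_pos by (simp add: field_simps)
qed

text \<open>
  Without arrivals the reward of an inactive action decays, and only updates, which bring in
  states with another active action, keep it positive.
\<close>

lemma inactive_mean:
  assumes k: "k \<in> {1..K}" and jk: "j \<noteq> k" and j: "j \<in> {1..K}"
  shows "E (\<lambda>w. active j w * x k w) \<le> real m * b * lam k"
proof -
  note eq = sum_share_of_bool[OF j]
  let ?l = "\<lambda>w. active j w * (lam k * active k w * (real (Suc (fst w k)) - real (fst w k))
         - x k w * (real (fst w k) - real (fst w k - 1)))"
  have inc: "\<bar>real (Suc n) - real n\<bar> \<le> 1" for n by simp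
  note bal = balance_product[of k real 1 "\<lambda>c. of_bool (c = j)", OF k inc, unfolded eq active_def[symmetric]]
  have l: "?l = (\<lambda>w. - (active j w * x k w))"
    using jk by (auto simp: fun_eq_iff x_def active_def of_nat_diff)
  have "E (\<lambda>w. active j w * x k w) = - E ?l" unfolding l by simp
  also have "\<dots> = b * E (\<lambda>w. - (real (fst w k) * (active j w - share j w)))"
    unfolding bal(1) by simp
  also have "\<dots> \<le> b * E (\<lambda>w. real m * x k w)"
  proof (intro mult_left_mono expectation_mono)
    fix w
    have "- (active j w - share j w) \<le> 1" using active_nonneg[of j w] share_le_1[OF j, of w] by linarith
    then have "real (fst w k) * - (active j w - share j w) \<le> real (fst w k) * 1"
      by (rule mult_left_mono) simp
    then show "- (real (fst w k) * (active j w - share j w)) \<le> real m * x k w"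
      using m_pos by (simp add: x_def algebra_simps)
  qed (use bal(3) integrable_x[OF k] b in auto)
  also have "\<dots> \<le> b * (real m * lam k)"
    using mean_x_bounds[OF k] b m_pos by simp
  finally show ?thesis by (simp add: algebra_simps)
qed

end

context reward_system
begin

section \<open>Abundant memory\<close>

definition excess :: "nat \<Rightarrow> state \<Rightarrow> real" where "excess k w = z k w - al"

definition inv_S :: "state \<Rightarrow> real" where "inv_S w = 1 / S w"

lemma excess_nonneg: "0 \<le> excess k w" using z_ge[of k w] by (simp add: excess_def)

lemma sum_excess: "(\<Sum>k=1..K. excess k w) = S w - real K * al"
  by (simp add: excess_def S_def sum_subtractf)

lemma excess_le_x: "excess k w \<le> x k w"
  using al x_nonneg[of k w] by (simp add: excess_def z_def)

lemma excess_eq: "x k w - al * (x k w / z k w) = excess k w"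
  using al by (auto simp: excess_def z_def max_def)

lemma inv_S_bound: "\<bar>inv_S w\<bar> \<le> 1 / (real K * al)"
  unfolding inv_S_def using S_ge[of w] S_pos[of w] K_al_pos by (simp add: frac_le)

lemma integrable_inv_S: "integrable \<pi> inv_S"
  by (rule integrable_bounded[OF inv_S_bound])

lemma integrable_x_over_z: "integrable \<pi> (\<lambda>w. x k w / z k w)"
  by (rule integrable_bounded[where c = 1]) (simp add: x_nonneg x_le_z z_pos less_imp_le)

lemma integrable_excess: "k \<in> {1..K} \<Longrightarrow> integrable \<pi> (excess k)"
  by (rule integrable_x_dominated[where c = 1 and d = 0 and k = k])
     (simp_all add: excess_nonneg excess_le_x)

lemma integrable_sum_excess: "integrable \<pi> (\<lambda>w. \<Sum>k=1..K. excess k w)"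
  by (rule Bochner_Integration.integrable_sum) (rule integrable_excess)

lemma S_eq: "S = (\<lambda>w. real K * al + (\<Sum>k=1..K. excess k w))"
  unfolding sum_excess by simp

lemma integrable_S: "integrable \<pi> S"
  unfolding S_eq using integrable_sum_excess by simp

lemma excess_over_S_bounds: "k \<in> {1..K} \<Longrightarrow> 0 \<le> excess k w / S w \<and> excess k w / S w \<le> 1"
  using excess_nonneg[of k w] z_le_S[of k w] S_pos[of w] al by (simp add: excess_def)

lemma integrable_excess_over_S: "k \<in> {1..K} \<Longrightarrow> integrable \<pi> (\<lambda>w. excess k w / S w)"
  by (rule integrable_bounded[where c = 1]) (metis excess_over_S_bounds abs_of_nonneg)

lemma E_excess_le: "k \<in> {1..K} \<Longrightarrow> E (excess k) \<le> lam k"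
  using expectation_mono[OF integrable_excess integrable_x excess_le_x] mean_x_bounds(2) by fastforce

lemma E_sum_excess: "E (\<lambda>w. \<Sum>k=1..K. excess k w) = (\<Sum>k=1..K. E (excess k))"
  by (rule Bochner_Integration.integral_sum) (rule integrable_excess)

lemma E_S: "E S = real K * al + (\<Sum>k=1..K. E (excess k))"
proof -
  have "E S = real K * al + E (\<lambda>w. \<Sum>k=1..K. excess k w)"
    unfolding S_eq using integrable_sum_excess by simp
  then show ?thesis unfolding E_sum_excess .
qed

lemma E_S_le: "E S \<le> real K * al + lamsum"
  unfolding E_S lamsum_def by (intro add_left_mono sum_mono E_excess_le)

text \<open>
  A common bound for the error terms of all coordinates: \<open>lamsum\<close> dominates every arrival rate, and
  the test function \<open>1 / max s al\<close> has Lipschitz constant \<open>1 / al\<^sup>2\<close>.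
\<close>

definition fast_err :: real where
  "fast_err = (lamsum + 2 * lamsum\<^sup>2) / al\<^sup>2 * (1 / real m + 1 / (real m * b))"

text \<open>
  Testing with \<open>\<phi> = 1 / z\<^sub>k\<close>, the choice for which \<open>\<phi> z\<^sub>k / S\<close> is the same for all coordinates.
\<close>

lemma averaging:
  assumes k: "k \<in> {1..K}"
  shows "\<bar>lam k * E inv_S - E (\<lambda>w. x k w / z k w)\<bar> \<le> fast_err"
proof -
  let ?\<phi> = "\<lambda>s::real. 1 / max s al"
  have lk: "0 < lam k" by (rule lam_pos[OF k])
  have B: "\<bar>?\<phi> s\<bar> \<le> 1 / al" for s
    using al by (simp add: frac_le)
  have L: "\<bar>?\<phi> s - ?\<phi> t\<bar> \<le> 1 / al\<^sup>2 * \<bar>s - t\<bar>" for s t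
  proof -
    have pos: "al\<^sup>2 \<le> max s al * max t al" "0 < max s al * max t al"
      using al by (simp_all add: power2_eq_square mult_mono)
    have "\<bar>?\<phi> s - ?\<phi> t\<bar> = \<bar>max s al - max t al\<bar> / (max s al * max t al)"
      using al by (intro abs_inverse_diff) auto
    also have "\<dots> \<le> \<bar>s - t\<bar> / al\<^sup>2"
      using pos al by (intro frac_le) auto
    finally show ?thesis by simp
  qed
  have phi: "?\<phi> (x k w) = 1 / z k w" for w by (simp add: z_def)
  have i1: "integrable \<pi> (\<lambda>w. active k w * (1 / z k w))"
    by (rule integrable_bounded[where c = "1 / al"])
       (use B[of "x k _"] active_01[of k] al in \<open>auto simp: phi[symmetric] active_def\<close>)
  have "1 / z k w * (active k w - share k w) = active k w * (1 / z k w) - inv_S w" for w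
    using z_pos[of k w] S_pos[of w] by (simp add: share_def inv_S_def field_simps)
  then have c: "\<bar>E (\<lambda>w. active k w * (1 / z k w)) - E inv_S\<bar>
      \<le> 2 * (1 / al\<^sup>2) * lam k / (real m * b)"
    using tested_choice[OF k L] i1 integrable_inv_S by (simp add: phi)
  have a: "\<bar>lam k * E (\<lambda>w. active k w * (1 / z k w)) - E (\<lambda>w. x k w / z k w)\<bar>
      \<le> 1 / al\<^sup>2 * lam k / real m"
    using tested_mean[OF k B L] by (simp add: phi)
  have "\<bar>lam k * E (\<lambda>w. active k w * (1 / z k w)) - lam k * E inv_S\<bar>
      \<le> lam k * (2 * (1 / al\<^sup>2) * lam k / (real m * b))"
    using mult_left_mono[OF c, of "lam k"] lk
    by (simp add: abs_mult right_diff_distrib[symmetric])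
  with a have "\<bar>lam k * E inv_S - E (\<lambda>w. x k w / z k w)\<bar>
      \<le> 1 / al\<^sup>2 * lam k / real m + lam k * (2 * (1 / al\<^sup>2) * lam k / (real m * b))"
    by linarith
  also have "\<dots> = (lam k / al\<^sup>2) * (1 / real m) + (2 * (lam k)\<^sup>2 / al\<^sup>2) * (1 / (real m * b))"
    by (simp add: power2_eq_square)
  also have "\<dots> \<le> ((lamsum + 2 * lamsum\<^sup>2) / al\<^sup>2) * (1 / real m)
      + ((lamsum + 2 * lamsum\<^sup>2) / al\<^sup>2) * (1 / (real m * b))"
  proof (intro add_mono mult_right_mono divide_right_mono)
    have "(lam k)\<^sup>2 \<le> lamsum\<^sup>2" using lam_le_lamsum[OF k] lk by (intro power_mono) auto
    then show "2 * (lam k)\<^sup>2 \<le> lamsum + 2 * lamsum\<^sup>2" using lamsum_nonneg by simp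
    show "lam k \<le> lamsum + 2 * lamsum\<^sup>2"
      using lam_le_lamsum[OF k] by (simp add: add_increasing2)
  qed (use b in auto)
  finally show ?thesis unfolding fast_err_def distrib_left .
qed

lemma fast_err_pos: "0 < fast_err"
proof -
  have "0 < lamsum" using lam_pos[of 1] lam_le_lamsum[of 1] K by simp
  then show ?thesis using al b m_pos by (simp add: fast_err_def add_pos_pos)
qed

text \<open>
  Since \<open>y\<^sub>k / S = z\<^sub>k / S - \<alpha> / S\<close> and \<open>y\<^sub>k = x\<^sub>k - \<alpha> x\<^sub>k / z\<^sub>k\<close>, this is the exact relation between \<open>E x\<^sub>k\<close> and
  \<open>E (z\<^sub>k / S)\<close> minus \<open>\<alpha>\<close> times the averaging estimate.
\<close>

lemma excess_balance:
  assumes k: "k \<in> {1..K}"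
  shows "\<bar>lam k * E (\<lambda>w. excess k w / S w) - E (excess k)\<bar> \<le> al * fast_err"
proof -
  have yS: "(\<lambda>w. excess k w / S w) = (\<lambda>w. share k w - al * inv_S w)"
    by (simp add: fun_eq_iff excess_def share_def inv_S_def diff_divide_distrib)
  have T: "E (\<lambda>w. excess k w / S w) = E (share k) - al * E inv_S"
    unfolding yS using integrable_share[OF k] integrable_inv_S by simp
  have Y: "E (excess k) = E (x k) - al * E (\<lambda>w. x k w / z k w)"
  proof -
    define V where "V = (\<lambda>w. x k w / z k w)"
    have "integrable \<pi> V" unfolding V_def by (rule integrable_x_over_z)
    moreover have "E (excess k) = E (\<lambda>w. x k w - al * V w)"
      by (rule expectation_cong) (simp only: V_def excess_eq)
    ultimately show ?thesis unfolding V_def[symmetric] using integrable_x[OF k] by simp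
  qed
  have "lam k * E (\<lambda>w. excess k w / S w) - E (excess k)
      = - (al * (lam k * E inv_S - E (\<lambda>w. x k w / z k w)))"
    unfolding T Y mean_x[OF k] action_share[OF k] by (simp add: algebra_simps)
  then show ?thesis
    using mult_left_mono[OF averaging[OF k], of al] al by (simp add: abs_mult)
qed

lemma E_active_decomposition:
  assumes k: "k \<in> {1..K}"
  shows "E (active k) = E (\<lambda>w. excess k w / S w) + al * E inv_S"
proof -
  have "E (share k) = E (\<lambda>w. excess k w / S w + al * inv_S w)"
    by (rule expectation_cong) (simp add: excess_def share_def inv_S_def diff_divide_distrib)
  then show ?thesis
    unfolding action_share[OF k] using integrable_excess_over_S[OF k] integrable_inv_S by simp
qed

lemma E_excess_over_S_bounds:
  assumes k: "k \<in> {1..K}"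
  shows "0 \<le> E (\<lambda>w. excess k w / S w)" "E (\<lambda>w. excess k w / S w) \<le> E (excess k) / (real K * al)"
proof -
  show "0 \<le> E (\<lambda>w. excess k w / S w)"
    using excess_over_S_bounds[OF k] by (intro Bochner_Integration.integral_nonneg) auto
  have "excess k w / S w \<le> excess k w / (real K * al)" for w
    using excess_nonneg[of k w] S_ge[of w] K_al_pos by (intro divide_left_mono) (auto simp: S_pos)
  then have "E (\<lambda>w. excess k w / S w) \<le> E (\<lambda>w. excess k w / (real K * al))"
    using integrable_excess_over_S[OF k] integrable_excess[OF k] by (intro expectation_mono) auto
  then show "E (\<lambda>w. excess k w / S w) \<le> E (excess k) / (real K * al)" by simp
qed

text \<open>
  The heart of the abundant regime. Expand
  \<open>E ((S - l)\<^sup>2 / S) = E S - 2 l + l\<^sup>2 E (1 / S)\<close>. The excess balances bound \<open>E S = K \<alpha> + \<Sum>\<^sub>k E y\<^sub>k\<close> from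
  above by \<open>K \<alpha> + l (1 - K \<alpha> E (1 / S)) + o(1)\<close>, after which the right-hand side factors as
  \<open>(l - K \<alpha>) (l E (1 / S) - 1) + o(1)\<close>. The averaging estimate for the best action shows that the
  second factor is at most \<open>o(1)\<close>, because \<open>x\<^sub>i \<le> z\<^sub>i\<close>.
\<close>

lemma normalizer_variance:
  assumes l: "\<And>j. j \<in> {1..K} \<Longrightarrow> lam j \<le> l" and i: "i \<in> {1..K}" "lam i = l"
    and dom: "real K * al \<le> l"
  shows "E (\<lambda>w. (S w - l)\<^sup>2 / S w) \<le> l * fast_err"
    and "integrable \<pi> (\<lambda>w. (S w - l)\<^sup>2 / S w)"
proof -
  have sq: "(S w - l)\<^sup>2 / S w = S w - 2 * l + l\<^sup>2 * inv_S w" for w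
    using S_pos[of w] by (simp add: inv_S_def field_simps power2_eq_square)
  show "integrable \<pi> (\<lambda>w. (S w - l)\<^sup>2 / S w)"
    unfolding sq using integrable_S integrable_inv_S by simp
  let ?s = "E inv_S"
  have "E (\<lambda>w. (S w - l)\<^sup>2 / S w) = E S - 2 * l + l\<^sup>2 * ?s"
    unfolding sq using integrable_S integrable_inv_S by simp
  moreover have "l * ?s \<le> 1 + fast_err"
  proof -
    have "E (\<lambda>w. x i w / z i w) \<le> E (\<lambda>w. 1)"
      by (intro expectation_mono integrable_x_over_z) (simp_all add: x_le_z z_pos)
    then show ?thesis using averaging[OF i(1)] i(2) by simp
  qed
  moreover have "(\<Sum>k=1..K. E (excess k)) \<le> l * (1 - real K * al * ?s) + real K * (al * fast_err)"
  proof -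
    have "E (excess k) \<le> l * E (\<lambda>w. excess k w / S w) + al * fast_err" if k: "k \<in> {1..K}" for k
      using excess_balance[OF k] mult_right_mono[OF l[OF k] E_excess_over_S_bounds(1)[OF k]]
      by linarith
    then have "(\<Sum>k=1..K. E (excess k)) \<le> (\<Sum>k=1..K. l * E (\<lambda>w. excess k w / S w) + al * fast_err)"
      by (rule sum_mono)
    also have "\<dots> = l * (\<Sum>k=1..K. E (\<lambda>w. excess k w / S w)) + real K * (al * fast_err)"
      by (simp add: sum.distrib sum_distrib_left)
    also have "(\<Sum>k=1..K. E (\<lambda>w. excess k w / S w)) = (\<Sum>k=1..K. E (active k) - al * ?s)"
      by (rule sum.cong) (use E_active_decomposition in auto)
    also have "\<dots> = 1 - real K * al * ?s"
      unfolding sum_subtractf sum_E_active by simp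
    finally show ?thesis .
  qed
  ultimately have "E (\<lambda>w. (S w - l)\<^sup>2 / S w)
      \<le> (l - real K * al) * (l * ?s - 1) + real K * al * fast_err"
    unfolding E_S by (simp add: algebra_simps power2_eq_square)
  also have "\<dots> \<le> (l - real K * al) * fast_err + real K * al * fast_err"
    using dom \<open>l * ?s \<le> 1 + fast_err\<close> by (intro add_right_mono mult_left_mono) auto
  finally show "E (\<lambda>w. (S w - l)\<^sup>2 / S w) \<le> l * fast_err" by (simp add: algebra_simps)
qed

text \<open>
  The weight \<open>sqrt fast_err\<close> balances the two terms of \<open>abs_diff_le_weighted\<close>.
\<close>

lemma normalizer_deviation:
  assumes l: "\<And>j. j \<in> {1..K} \<Longrightarrow> lam j \<le> l" and i: "i \<in> {1..K}" "lam i = l"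
    and dom: "real K * al \<le> l"
  shows "E (\<lambda>w. \<bar>S w - l\<bar>) \<le> sqrt fast_err * (real K * al + lamsum + l)"
proof -
  let ?e = "sqrt fast_err"
  have e: "0 < ?e" using fast_err_pos by simp
  define V where "V = (\<lambda>w. (S w - l)\<^sup>2 / S w)"
  have v: "E V \<le> l * fast_err" "integrable \<pi> V"
    unfolding V_def by (rule normalizer_variance[OF l i dom]; assumption)+
  have "E (\<lambda>w. \<bar>S w - l\<bar>) \<le> E (\<lambda>w. ?e / 2 * S w + V w / (2 * ?e))"
  proof (intro expectation_mono)
    show "\<bar>S w - l\<bar> \<le> ?e / 2 * S w + V w / (2 * ?e)" for w
      unfolding V_def by (rule abs_diff_le_weighted[OF S_pos e])
  qed (use integrable_S v(2) in simp_all)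
  also have "\<dots> = ?e / 2 * E S + E V / (2 * ?e)"
    using integrable_S v(2) by simp
  also have "\<dots> \<le> ?e / 2 * (real K * al + lamsum) + l * fast_err / (2 * ?e)"
    using e E_S_le v(1) by (intro add_mono mult_left_mono divide_right_mono) auto
  also have "l * fast_err / (2 * ?e) = ?e / 2 * l"
    using e fast_err_pos real_sqrt_mult_self[of fast_err] by (simp add: field_simps)
  also have "?e / 2 * (real K * al + lamsum) + ?e / 2 * l = (?e * (real K * al + lamsum + l)) / 2"
    by (simp add: algebra_simps)
  also have "\<dots> \<le> ?e * (real K * al + lamsum + l)"
  proof -
    have "0 \<le> real K * al + lamsum + l" using K_al_pos lamsum_nonneg dom by linarith
    from mult_nonneg_nonneg[OF less_imp_le[OF e] this] show ?thesis by linarith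
  qed
  finally show ?thesis .
qed

text \<open>
  With \<open>S\<close> close to \<open>l\<close>, the excess balance of a worse action reads
  \<open>E y\<^sub>k \<le> (lam k / l) E y\<^sub>k + o(1)\<close>, so its excess vanishes and its reward counts as \<open>\<alpha>\<close> in the
  choice probability.
\<close>

lemma abundant_dominant_bound:
  assumes l: "\<And>j. j \<in> {1..K} \<Longrightarrow> lam j \<le> l" and i: "i \<in> {1..K}" "lam i = l"
    and dom: "real K * al \<le> l" and k: "k \<in> {1..K}" and less: "lam k < l"
  defines "D \<equiv> real K * al + lamsum + l"
  shows "\<bar>E (active k) - al / l\<bar>
    \<le> (lam k / l * (sqrt fast_err * D) + al * fast_err) / (1 - lam k / l) / (real K * al)
      + sqrt fast_err * D / (real K * l)"
proof -
  have lk: "0 < lam k" by (rule lam_pos[OF k])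
  with less have l0: "0 < l" by simp
  let ?s = "E inv_S" and ?T = "E (\<lambda>w. excess k w / S w)" and ?d = "E (\<lambda>w. \<bar>S w - l\<bar>)"
  have d: "?d \<le> sqrt fast_err * D" unfolding D_def by (rule normalizer_deviation[OF l i dom])
  have id: "integrable \<pi> (\<lambda>w. \<bar>S w - l\<bar>)" using integrable_S by simp
  have inv: "\<bar>inv_S w - 1 / l\<bar> = \<bar>S w - l\<bar> / (S w * l)" for w
    unfolding inv_S_def by (rule abs_inverse_diff[OF S_pos l0])
  have "?T \<le> E (\<lambda>w. excess k w / l + \<bar>S w - l\<bar> / l)"
  proof (intro expectation_mono integrable_excess_over_S[OF k])
    fix w
    have "excess k w / S w - excess k w / l \<le> excess k w * \<bar>inv_S w - 1 / l\<bar>"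
      using mult_left_mono[OF abs_ge_self excess_nonneg[of k w], of "inv_S w - 1 / l"]
      by (simp add: inv_S_def right_diff_distrib)
    also have "\<dots> = excess k w / S w * (\<bar>S w - l\<bar> / l)" unfolding inv by simp
    also have "\<dots> \<le> 1 * (\<bar>S w - l\<bar> / l)"
      using excess_over_S_bounds[OF k, of w] l0 by (intro mult_right_mono) auto
    finally show "excess k w / S w \<le> excess k w / l + \<bar>S w - l\<bar> / l" by simp
  qed (use integrable_excess[OF k] id in simp)
  also have "\<dots> = E (excess k) / l + ?d / l" using integrable_excess[OF k] id by simp
  also have "\<dots> \<le> E (excess k) / l + sqrt fast_err * D / l"
    using d l0 by (intro add_left_mono divide_right_mono) auto
  finally have "lam k * ?T \<le> lam k * (E (excess k) / l + sqrt fast_err * D / l)"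
    using lk by (intro mult_left_mono) auto
  with excess_balance[OF k]
  have "E (excess k) \<le> lam k * (E (excess k) / l + sqrt fast_err * D / l) + al * fast_err" by linarith
  then have "E (excess k) * (1 - lam k / l) \<le> lam k / l * (sqrt fast_err * D) + al * fast_err"
    by (simp add: algebra_simps)
  then have Y: "E (excess k) \<le> (lam k / l * (sqrt fast_err * D) + al * fast_err) / (1 - lam k / l)"
    using less l0 by (simp add: pos_le_divide_eq)
  have T: "?T \<le> (lam k / l * (sqrt fast_err * D) + al * fast_err) / (1 - lam k / l) / (real K * al)"
    using E_excess_over_S_bounds(2)[OF k] divide_right_mono[OF Y, of "real K * al"] K_al_pos by linarith
  have "\<bar>?s - 1 / l\<bar> = \<bar>E (\<lambda>w. inv_S w - 1 / l)\<bar>" using integrable_inv_S by simp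
  also have "\<dots> \<le> E (\<lambda>w. \<bar>inv_S w - 1 / l\<bar>)" by (rule integral_abs_bound)
  also have "\<dots> \<le> E (\<lambda>w. \<bar>S w - l\<bar> / (real K * al * l))"
  proof (rule expectation_mono)
    fix w
    show "\<bar>inv_S w - 1 / l\<bar> \<le> \<bar>S w - l\<bar> / (real K * al * l)"
      unfolding inv using S_ge[of w] K al l0
      by (intro divide_left_mono mult_right_mono mult_pos_pos S_pos) auto
  qed (use integrable_inv_S id in auto)
  also have "\<dots> = ?d / (real K * al * l)" by simp
  also have "\<dots> \<le> sqrt fast_err * D / (real K * al * l)"
    using d K_al_pos l0 by (intro divide_right_mono) auto
  finally have "al * \<bar>?s - 1 / l\<bar> \<le> al * (sqrt fast_err * D / (real K * al * l))"
    using al by (intro mult_left_mono) auto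
  moreover have scale: "\<bar>al * ?s - al / l\<bar> = al * \<bar>?s - 1 / l\<bar>"
  proof -
    have "\<bar>al * ?s - al / l\<bar> = \<bar>al * (?s - 1 / l)\<bar>" by (simp add: right_diff_distrib)
    then show ?thesis using al by (simp add: abs_mult)
  qed
  ultimately have s: "\<bar>al * ?s - al / l\<bar> \<le> sqrt fast_err * D / (real K * l)"
    unfolding scale using al by simp
  show ?thesis
    unfolding E_active_decomposition[OF k] using T s E_excess_over_S_bounds(1)[OF k] by linarith
qed

text \<open>
  Here already the trivial bound \<open>S \<ge> K \<alpha> > l\<close> turns the excess balances into
  \<open>E y\<^sub>j \<le> (l / (K \<alpha>)) E y\<^sub>j + o(1)\<close>: no action rises above the threshold.
\<close>

lemma abundant_subcritical_bound:
  assumes l: "\<And>j. j \<in> {1..K} \<Longrightarrow> lam j \<le> l" and sub: "l < real K * al" and k: "k \<in> {1..K}"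
  defines "Y \<equiv> al * fast_err / (1 - l / (real K * al))"
  shows "\<bar>E (active k) - 1 / real K\<bar> \<le> Y / (real K * al) + al * (real K * Y / (real K * al)\<^sup>2)"
proof -
  let ?A = "real K * al" and ?s = "E inv_S"
  have yb: "E (excess j) \<le> Y" if j: "j \<in> {1..K}" for j
  proof -
    have "lam j * E (\<lambda>w. excess j w / S w) \<le> l * (E (excess j) / ?A)"
      using l[OF j] E_excess_over_S_bounds[OF j] lam_pos[OF j] by (intro mult_mono) auto
    with excess_balance[OF j] have "E (excess j) \<le> l * (E (excess j) / ?A) + al * fast_err" by linarith
    then have "E (excess j) * (1 - l / ?A) \<le> al * fast_err" by (simp add: algebra_simps)
    then show ?thesis unfolding Y_def using sub K_al_pos by (simp add: pos_le_divide_eq)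
  qed
  have inv: "\<bar>inv_S w - 1 / ?A\<bar> \<le> (\<Sum>j=1..K. excess j w) / ?A\<^sup>2" for w
  proof -
    have "\<bar>inv_S w - 1 / ?A\<bar> = (S w - ?A) / (S w * ?A)"
      unfolding inv_S_def abs_inverse_diff[OF S_pos K_al_pos] using S_ge[of w] by simp
    also have "\<dots> \<le> (S w - ?A) / (?A * ?A)"
      using S_ge[of w] K al
      by (intro divide_left_mono mult_right_mono mult_pos_pos S_pos) auto
    finally show ?thesis by (simp add: sum_excess[unfolded One_nat_def] power2_eq_square)
  qed
  have "\<bar>?s - 1 / ?A\<bar> = \<bar>E (\<lambda>w. inv_S w - 1 / ?A)\<bar>" using integrable_inv_S by simp
  also have "\<dots> \<le> E (\<lambda>w. \<bar>inv_S w - 1 / ?A\<bar>)" by (rule integral_abs_bound)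
  also have "\<dots> \<le> E (\<lambda>w. (\<Sum>j=1..K. excess j w) / ?A\<^sup>2)"
    by (rule expectation_mono) (use integrable_inv_S integrable_sum_excess inv in auto)
  also have "\<dots> = (\<Sum>j=1..K. E (excess j)) / ?A\<^sup>2"
    unfolding E_sum_excess[symmetric] by simp
  also have "\<dots> \<le> real K * Y / ?A\<^sup>2"
    using sum_mono[of "{1..K}" "\<lambda>j. E (excess j)" "\<lambda>_. Y"] yb by (intro divide_right_mono) auto
  finally have "al * \<bar>?s - 1 / ?A\<bar> \<le> al * (real K * Y / ?A\<^sup>2)"
    using al by (intro mult_left_mono) auto
  also have "al * \<bar>?s - 1 / ?A\<bar> = \<bar>al * ?s - 1 / real K\<bar>"
  proof -
    have "\<bar>al * ?s - 1 / real K\<bar> = \<bar>al * (?s - 1 / ?A)\<bar>" using al by (simp add: right_diff_distrib)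
    then show ?thesis using al by (simp add: abs_mult)
  qed
  finally have s: "\<bar>al * ?s - 1 / real K\<bar> \<le> al * (real K * Y / ?A\<^sup>2)" .
  have T: "E (\<lambda>w. excess k w / S w) \<le> Y / ?A"
    using E_excess_over_S_bounds(2)[OF k] divide_right_mono[OF yb[OF k], of ?A] K_al_pos by linarith
  show ?thesis
    unfolding E_active_decomposition[OF k] using s T E_excess_over_S_bounds(1)[OF k] by linarith
qed

end

section \<open>Deficient memory\<close>

lemma share_lipschitz:
  fixes u v :: "'i \<Rightarrow> real"
  assumes I: "finite I" "j \<in> I" and a: "0 < a"
    and u: "\<And>i. i \<in> I \<Longrightarrow> a \<le> u i" and v: "\<And>i. i \<in> I \<Longrightarrow> a \<le> v i"
  shows "\<bar>u j / sum u I - v j / sum v I\<bar> \<le> 2 / (real (card I) * a) * (\<Sum>i\<in>I. \<bar>u i - v i\<bar>)"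
proof -
  let ?d = "\<Sum>i\<in>I. \<bar>u i - v i\<bar>" and ?A = "real (card I) * a"
  have "0 < card I" using I card_gt_0_iff by blast
  then have A: "0 < ?A" using a by simp
  have U: "?A \<le> sum u I" and V: "?A \<le> sum v I"
    using sum_bounded_below[of I a u] sum_bounded_below[of I a v] u v by auto
  have pos: "0 < sum u I" "0 < sum v I" using A U V by linarith+
  have dj: "\<bar>u j - v j\<bar> \<le> ?d" using I by (intro member_le_sum) auto
  have ds: "\<bar>sum v I - sum u I\<bar> \<le> ?d"
    using sum_abs[of "\<lambda>i. v i - u i" I] by (simp add: sum_subtractf abs_minus_commute)
  have vj: "0 \<le> v j" "v j \<le> sum v I"
    using I v[of j] a order.trans[OF less_imp_le[OF a] v] by (auto intro: member_le_sum)
  have "u j / sum u I - v j / sum v I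
      = (u j - v j) / sum u I + v j / sum v I * ((sum v I - sum u I) / sum u I)"
    using pos by (simp add: field_simps)
  also have "\<bar>\<dots>\<bar> \<le> \<bar>u j - v j\<bar> / sum u I + v j / sum v I * (\<bar>sum v I - sum u I\<bar> / sum u I)"
    using pos vj by (intro order.trans[OF abs_triangle_ineq]) (simp add: abs_mult)
  also have "\<dots> \<le> ?d / ?A + 1 * (?d / ?A)"
    using pos vj dj ds U A by (intro add_mono mult_mono frac_le) auto
  finally show ?thesis by (simp add: mult.commute)
qed

context reward_system
begin

definition slow_err :: real where
  "slow_err = 3 * lamsum * (real m * b) + 2 / real m"

lemma slow_err_pos: "0 < slow_err"
  using b m_pos lamsum_nonneg by (simp add: slow_err_def add_nonneg_pos)

text \<open>
  The quotient equals \<open>(x - \<lambda>) (1 - 2 \<lambda> / (x + \<lambda>))\<close>, a combination of the bounded Lipschitz tests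
  \<open>\<phi> = 1\<close> and \<open>\<phi> = 1 / (x + \<lambda>)\<close> times \<open>x - \<lambda>\<close>. The square \<open>(x - \<lambda>)\<^sup>2\<close> itself would need second moments.
\<close>

lemma active_variance:
  assumes k: "k \<in> {1..K}"
  shows "E (\<lambda>w. active k w * ((x k w - lam k)\<^sup>2 / (x k w + lam k))) \<le> slow_err"
    and "integrable \<pi> (\<lambda>w. active k w * ((x k w - lam k)\<^sup>2 / (x k w + lam k)))"
proof -
  let ?l = "lam k"
  have l: "0 < ?l" by (rule lam_pos[OF k])
  have den: "0 < x k w + ?l" for w using l x_nonneg[of k w] by linarith
  define a where "a = (\<lambda>w. active k w * (1 * (?l - x k w)))"
  define c where "c = (\<lambda>w. active k w * (1 / (x k w + ?l) * (?l - x k w)))"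
  have eq: "active k w * ((x k w - ?l)\<^sup>2 / (x k w + ?l)) = 2 * ?l * c w - a w" for w
    unfolding a_def c_def using den[of w] by (simp add: field_simps power2_eq_square)
  have ia: "integrable \<pi> a"
  proof (rule integrable_x_dominated[OF k, where c = 1 and d = ?l])
    show "\<bar>a w\<bar> \<le> 1 * x k w + ?l" for w
      unfolding a_def using l x_nonneg[of k w] active_01[of k w] by auto
  qed simp
  have ic: "integrable \<pi> c"
  proof (rule integrable_bounded[where c = 1])
    fix w
    have "\<bar>?l - x k w\<bar> \<le> x k w + ?l" using l x_nonneg[of k w] by linarith
    then show "\<bar>c w\<bar> \<le> 1" using den[of w] by (simp add: c_def active_def)
  qed
  show "integrable \<pi> (\<lambda>w. active k w * ((x k w - ?l)\<^sup>2 / (x k w + ?l)))"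
    unfolding eq using ia ic by simp
  have B: "\<bar>1 / (s + ?l)\<bar> \<le> 1 / ?l" if "0 \<le> s" for s
  proof -
    have "1 / (s + ?l) \<le> 1 / ?l" using that l by (intro divide_left_mono) auto
    then show ?thesis using that l by (simp add: abs_of_pos)
  qed
  have L: "\<bar>1 / (s + ?l) - 1 / (t + ?l)\<bar> \<le> 1 / ?l\<^sup>2 * \<bar>s - t\<bar>" if "0 \<le> s" "0 \<le> t" for s t
  proof -
    have "\<bar>1 / (s + ?l) - 1 / (t + ?l)\<bar> = \<bar>s - t\<bar> / ((s + ?l) * (t + ?l))"
      using abs_inverse_diff[of "s + ?l" "t + ?l"] that l by simp
    also have "\<dots> \<le> \<bar>s - t\<bar> / ?l\<^sup>2"
      unfolding power2_eq_square using that l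
      by (intro divide_left_mono mult_mono mult_pos_pos) auto
    finally show ?thesis by simp
  qed
  have c_bound: "\<bar>E c\<bar> \<le> 1 / ?l\<^sup>2 * ?l / real m + real m * b * (1 / ?l) * ?l"
    unfolding c_def by (rule tested_active[OF k B L])
  have a_bound: "\<bar>E a\<bar> \<le> 0 * ?l / real m + real m * b * 1 * ?l"
    unfolding a_def by (rule tested_active[OF k, where \<phi> = "\<lambda>_. 1"]) auto
  have "E (\<lambda>w. active k w * ((x k w - ?l)\<^sup>2 / (x k w + ?l))) = 2 * ?l * E c - E a"
    unfolding eq using ia ic by simp
  also have "\<dots> \<le> 2 * ?l * (1 / ?l\<^sup>2 * ?l / real m + real m * b * (1 / ?l) * ?l) + real m * b * ?l"
    using a_bound mult_left_mono[OF order.trans[OF abs_ge_self c_bound], of "2 * ?l"] l by linarith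
  also have "\<dots> = 3 * ?l * (real m * b) + 2 / real m"
    using l by (simp add: field_simps power2_eq_square)
  also have "\<dots> \<le> slow_err"
    unfolding slow_err_def using lam_le_lamsum[OF k] b m_pos
    by (intro add_right_mono mult_right_mono) auto
  finally show "E (\<lambda>w. active k w * ((x k w - ?l)\<^sup>2 / (x k w + ?l))) \<le> slow_err" .
qed

lemma active_deviation:
  assumes k: "k \<in> {1..K}"
  shows "E (\<lambda>w. active k w * \<bar>x k w - lam k\<bar>) \<le> sqrt slow_err * (lamsum + 1)"
    and "integrable \<pi> (\<lambda>w. active k w * \<bar>x k w - lam k\<bar>)"
proof -
  let ?l = "lam k" and ?e = "sqrt slow_err"
  have l: "0 < ?l" by (rule lam_pos[OF k])
  have e: "0 < ?e" using slow_err_pos by simp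
  define V where "V = (\<lambda>w. active k w * ((x k w - ?l)\<^sup>2 / (x k w + ?l)))"
  have v: "E V \<le> slow_err" "integrable \<pi> V"
    unfolding V_def by (rule active_variance[OF k])+
  have den: "0 < x k w + ?l" for w using l x_nonneg[of k w] by linarith
  show i: "integrable \<pi> (\<lambda>w. active k w * \<bar>x k w - ?l\<bar>)"
  proof (rule integrable_x_dominated[OF k, where c = 1 and d = ?l])
    show "\<bar>active k w * \<bar>x k w - ?l\<bar>\<bar> \<le> 1 * x k w + ?l" for w
      using l x_nonneg[of k w] active_01[of k w] by auto
  qed simp
  have bound: "active k w * \<bar>x k w - ?l\<bar> \<le> ?e / 2 * (x k w + ?l) + V w / ?e" for w
  proof (cases "active k w = 0")
    case True
    then show ?thesis using e den[of w] by (simp add: V_def)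
  next
    case False
    then have active: "active k w = 1" using active_01[of k w] by simp
    \<comment> \<open>the weighted inequality at \<open>s = x + \<lambda>\<close>, \<open>l = 2 \<lambda>\<close>, where \<open>s - l = x - \<lambda>\<close>\<close>
    have "\<bar>x k w - ?l\<bar> \<le> ?e / 2 * (x k w + ?l) + (x k w - ?l)\<^sup>2 / (x k w + ?l) / (2 * ?e)"
      using abs_diff_le_weighted[OF den[of w] e, of "2 * ?l"] by simp
    also have "\<dots> \<le> ?e / 2 * (x k w + ?l) + (x k w - ?l)\<^sup>2 / (x k w + ?l) / ?e"
      using e den[of w] by (intro add_left_mono divide_left_mono) auto
    finally show ?thesis unfolding V_def active by simp
  qed
  have "E (\<lambda>w. active k w * \<bar>x k w - ?l\<bar>)
      \<le> E (\<lambda>w. ?e / 2 * (x k w + ?l) + V w / ?e)"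
    using integrable_x[OF k] v(2) bound by (intro expectation_mono i) auto
  also have "\<dots> = ?e / 2 * (E (x k) + ?l) + E V / ?e"
    using integrable_x[OF k] v(2) by simp
  also have "\<dots> \<le> ?e / 2 * (2 * lamsum) + slow_err / ?e"
    using e v(1) mean_x_bounds(2)[OF k] lam_le_lamsum[OF k]
    by (intro add_mono mult_left_mono divide_right_mono) auto
  also have "slow_err / ?e = ?e" using slow_err_pos by (simp add: real_div_sqrt)
  finally show "E (\<lambda>w. active k w * \<bar>x k w - ?l\<bar>) \<le> ?e * (lamsum + 1)" by (simp add: algebra_simps)
qed

text \<open>
  In the idealized state of action \<open>i\<close>, where \<open>x\<^sub>i = lam i\<close> and all other coordinates are \<open>0\<close>, the
  normalizer \<open>S\<close> equals \<open>weight i\<close>, and \<open>slow_share i j\<close> is the probability that an update chooses \<open>j\<close>.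
\<close>

definition weight :: "nat \<Rightarrow> real" where "weight k = max (lam k) al + (real K - 1) * al"

definition slow_share :: "nat \<Rightarrow> nat \<Rightarrow> real" where
  "slow_share i j = (if j = i then max (lam i) al else al) / weight i"

definition slow_dist :: real where
  "slow_dist = 2 / (real K * al) * (real m * b * lamsum + sqrt slow_err * (lamsum + 1))"

lemma weight_pos: "0 < weight k"
proof -
  have "0 < max (lam k) al" "0 \<le> (real K - 1) * al" using al K by auto
  then show ?thesis by (simp add: weight_def)
qed

lemma frozen_action_share:
  assumes i: "i \<in> {1..K}" and j: "j \<in> {1..K}"
  shows "\<bar>E (\<lambda>w. active i w * share j w) - slow_share i j * E (active i)\<bar> \<le> slow_dist"
    and "integrable \<pi> (\<lambda>w. active i w * share j w)"
proof -
  let ?v = "\<lambda>k. if k = i then max (lam i) al else al"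
  let ?c = "2 / (real K * al)"
  define d where
    "d = (\<lambda>w. active i w * \<bar>x i w - lam i\<bar> + (\<Sum>k\<in>{1..K} - {i}. active i w * x k w))"
  have sumv: "(\<Sum>k=1..K. ?v k) = weight i"
    using i by (simp add: sum.remove[of _ i] weight_def of_nat_diff)
  show ip: "integrable \<pi> (\<lambda>w. active i w * share j w)"
    by (rule integrable_bounded[where c = 1]) (use share_nonneg[of j] share_le_1[OF j] in \<open>auto simp: active_def\<close>)
  have ix: "integrable \<pi> (\<lambda>w. active i w * x k w)" if k: "k \<in> {1..K}" for k
    by (rule integrable_x_dominated[OF k, where c = 1 and d = 0])
       (use x_nonneg[of k] in \<open>auto simp: active_def\<close>)
  have id: "integrable \<pi> d"
    unfolding d_def
    using active_deviation(2)[OF i] ix by (intro Bochner_Integration.integrable_add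
        Bochner_Integration.integrable_sum) auto
  have lip: "\<bar>share j w - slow_share i j\<bar> \<le> ?c * (\<Sum>k=1..K. \<bar>z k w - ?v k\<bar>)" for w
    using share_lipschitz[of "{1..K}" j al "\<lambda>k. z k w" ?v] j al z_ge
    unfolding share_def S_def slow_share_def sumv by simp
  have bound: "active i w * \<bar>share j w - slow_share i j\<bar> \<le> ?c * d w" for w
  proof (cases "active i w = 0")
    case False
    then have active: "active i w = 1" using active_01[of i w] by simp
    have "(\<Sum>k=1..K. \<bar>z k w - ?v k\<bar>)
        = \<bar>z i w - max (lam i) al\<bar> + (\<Sum>k\<in>{1..K} - {i}. \<bar>z k w - al\<bar>)"
      using i by (simp add: sum.remove[of _ i])
    also have "\<dots> \<le> \<bar>x i w - lam i\<bar> + (\<Sum>k\<in>{1..K} - {i}. x k w)"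
    proof (intro add_mono sum_mono)
      show "\<bar>z i w - max (lam i) al\<bar> \<le> \<bar>x i w - lam i\<bar>" by (auto simp: z_def)
      show "\<bar>z k w - al\<bar> \<le> x k w" for k
        using excess_nonneg[of k w] excess_le_x[of k w] by (simp add: excess_def)
    qed
    finally have "?c * (\<Sum>k=1..K. \<bar>z k w - ?v k\<bar>)
        \<le> ?c * (\<bar>x i w - lam i\<bar> + (\<Sum>k\<in>{1..K} - {i}. x k w))"
      using K_al_pos by (intro mult_left_mono) auto
    then show ?thesis using lip[of w] unfolding active d_def by simp
  qed (simp add: d_def)
  have "E (\<lambda>w. active i w * share j w) - slow_share i j * E (active i)
      = E (\<lambda>w. active i w * (share j w - slow_share i j))"
    using ip integrable_active[of i] by (simp add: right_diff_distrib mult.commute)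
  also have "\<bar>\<dots>\<bar> \<le> E (\<lambda>w. \<bar>active i w * (share j w - slow_share i j)\<bar>)" by (rule integral_abs_bound)
  also have "\<dots> \<le> E (\<lambda>w. ?c * d w)"
  proof (rule expectation_mono)
    show "integrable \<pi> (\<lambda>w. \<bar>active i w * (share j w - slow_share i j)\<bar>)"
      using ip integrable_active[of i] by (simp add: right_diff_distrib)
    show "integrable \<pi> (\<lambda>w. ?c * d w)" using id by simp
    show "\<bar>active i w * (share j w - slow_share i j)\<bar> \<le> ?c * d w" for w
      using bound[of w] active_nonneg[of i w] by (simp add: abs_mult)
  qed
  also have "\<dots> = ?c * E d" by simp
  also have "E d = (E (\<lambda>w. active i w * \<bar>x i w - lam i\<bar>) + (\<Sum>k\<in>{1..K} - {i}. E (\<lambda>w. active i w * x k w)))"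
  proof -
    have "E d = E (\<lambda>w. active i w * \<bar>x i w - lam i\<bar>) + E (\<lambda>w. \<Sum>k\<in>{1..K} - {i}. active i w * x k w)"
      unfolding d_def using active_deviation(2)[OF i] ix
      by (intro Bochner_Integration.integral_add Bochner_Integration.integrable_sum) auto
    also have "E (\<lambda>w. \<Sum>k\<in>{1..K} - {i}. active i w * x k w)
        = (\<Sum>k\<in>{1..K} - {i}. E (\<lambda>w. active i w * x k w))"
      by (rule Bochner_Integration.integral_sum) (use ix in auto)
    finally show ?thesis .
  qed
  also have "?c * \<dots> \<le> ?c * (sqrt slow_err * (lamsum + 1) + (\<Sum>k\<in>{1..K} - {i}. real m * b * lam k))"
    using K_al_pos active_deviation(1)[OF i] inactive_mean[OF _ _ i]
    by (intro mult_left_mono add_mono sum_mono) auto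
  also have "\<dots> \<le> ?c * (sqrt slow_err * (lamsum + 1) + real m * b * lamsum)"
  proof (intro mult_left_mono add_left_mono)
    have "(\<Sum>k\<in>{1..K} - {i}. lam k) \<le> lamsum"
      unfolding lamsum_def by (rule sum_mono2) (use lam_pos in \<open>auto intro: less_imp_le\<close>)
    then show "(\<Sum>k\<in>{1..K} - {i}. real m * b * lam k) \<le> real m * b * lamsum"
      unfolding sum_distrib_left[symmetric] using b by (intro mult_left_mono) auto
  qed (use K_al_pos in auto)
  finally show "\<bar>E (\<lambda>w. active i w * share j w) - slow_share i j * E (active i)\<bar> \<le> slow_dist"
    by (simp add: slow_dist_def add.commute)
qed

text \<open>
  The law of the action is almost stationary for the Markov chain with transition matrix
  \<open>slow_share\<close>.
\<close>

lemma slow_equation: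
  assumes j: "j \<in> {1..K}"
  shows "\<bar>E (active j) - (\<Sum>i=1..K. slow_share i j * E (active i))\<bar> \<le> real K * slow_dist"
proof -
  have "E (active j) = E (\<lambda>w. \<Sum>i=1..K. active i w * share j w)"
    unfolding action_share[OF j]
    by (rule expectation_cong) (simp only: sum_distrib_right[symmetric] sum_active mult_1_left)
  also have "\<dots> = (\<Sum>i=1..K. E (\<lambda>w. active i w * share j w))"
    by (rule Bochner_Integration.integral_sum) (rule frozen_action_share(2)[OF _ j])
  finally have "\<bar>E (active j) - (\<Sum>i=1..K. slow_share i j * E (active i))\<bar>
      = \<bar>\<Sum>i=1..K. E (\<lambda>w. active i w * share j w) - slow_share i j * E (active i)\<bar>"
    by (simp add: sum_subtractf)
  also have "\<dots> \<le> (\<Sum>i=1..K. \<bar>E (\<lambda>w. active i w * share j w) - slow_share i j * E (active i)\<bar>)"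
    by (rule sum_abs)
  also have "\<dots> \<le> (\<Sum>i=1..K. slow_dist)" by (rule sum_mono) (rule frozen_action_share(1)[OF _ j])
  finally show ?thesis by simp
qed

text \<open>
  The off-diagonal entries of \<open>slow_share\<close> depend on the row only through \<open>1 / weight i\<close>. In terms of
  \<open>u i = P(c = i) / weight i\<close> the stationarity equation for \<open>j\<close> therefore collapses to
  \<open>K u j = \<Sum>\<^sub>i u i\<close>, up to the error. So all \<open>u j\<close> nearly agree, and \<open>\<Sum>\<^sub>j weight j u j = 1\<close>
  determines their common value.
\<close>

lemma deficient_bound:
  assumes k: "k \<in> {1..K}"
  shows "\<bar>E (active k) - weight k / (\<Sum>i=1..K. weight i)\<bar> \<le> weight k * (2 * slow_dist / al)"
proof -
  define u where "u = (\<lambda>i. E (active i) / weight i)"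
  define U where "U = (\<Sum>i=1..K. u i)"
  let ?r = "real K * slow_dist / al" and ?weight = "\<Sum>i=1..K. weight i"
  have Kpos: "0 < real K" using K by simp
  have Dpos: "0 < ?weight" by (rule sum_pos) (use K weight_pos in auto)
  have q: "E (active i) = weight i * u i" for i using weight_pos[of i] by (simp add: u_def)
  have dev: "\<bar>real K * u j - U\<bar> \<le> ?r" if j: "j \<in> {1..K}" for j
  proof -
    have "(\<Sum>i=1..K. slow_share i j * E (active i))
        = (\<Sum>i=1..K. al * u i + (if i = j then (max (lam j) al - al) * u j else 0))"
      by (rule sum.cong) (auto simp: slow_share_def u_def algebra_simps diff_divide_distrib)
    also have "\<dots> = al * U + (max (lam j) al - al) * u j"
      using j by (simp add: sum.distrib sum_distrib_left U_def sum.delta)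
    finally have "E (active j) - (\<Sum>i=1..K. slow_share i j * E (active i)) = al * (real K * u j - U)"
      unfolding q[of j] by (simp add: weight_def algebra_simps)
    then have "al * \<bar>real K * u j - U\<bar> \<le> real K * slow_dist"
      using slow_equation[OF j] al by (simp add: abs_mult)
    then show ?thesis using al by (simp add: pos_le_divide_eq mult.commute)
  qed
  have one: "(\<Sum>j=1..K. weight j * u j) = 1" using sum_E_active by (simp add: q)
  have "real K - U * ?weight = real K * (\<Sum>j=1..K. weight j * u j) - U * ?weight" unfolding one by simp
  also have "\<dots> = (\<Sum>j=1..K. weight j * (real K * u j - U))"
    by (simp add: sum_distrib_left right_diff_distrib sum_subtractf ac_simps)
  finally have "\<bar>real K - U * ?weight\<bar> \<le> (\<Sum>j=1..K. \<bar>weight j * (real K * u j - U)\<bar>)"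
    by (simp only: sum_abs)
  also have "\<dots> \<le> (\<Sum>j=1..K. weight j * ?r)"
    unfolding abs_mult abs_of_pos[OF weight_pos]
    by (intro sum_mono mult_left_mono dev less_imp_le[OF weight_pos])
  finally have U: "\<bar>real K - U * ?weight\<bar> \<le> ?r * ?weight" by (simp only: sum_distrib_right mult.commute)
  have "\<bar>real K * u k * ?weight - real K\<bar> \<le> 2 * ?r * ?weight"
  proof -
    have "\<bar>(real K * u k - U) * ?weight\<bar> \<le> ?r * ?weight"
      unfolding abs_mult using dev[OF k] Dpos by (intro mult_mono) auto
    moreover have "real K * u k * ?weight - real K = (real K * u k - U) * ?weight - (real K - U * ?weight)"
      by (simp add: algebra_simps)
    ultimately show ?thesis using U by linarith
  qed
  also have "2 * ?r * ?weight = real K * ?weight * (2 * slow_dist / al)" by simp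
  also have "real K * u k * ?weight - real K = real K * ?weight * (u k - 1 / ?weight)"
    using Dpos by (simp add: field_simps)
  also have "\<bar>real K * ?weight * (u k - 1 / ?weight)\<bar> = real K * ?weight * \<bar>u k - 1 / ?weight\<bar>"
    using Dpos Kpos by (simp add: abs_mult)
  finally have "\<bar>u k - 1 / ?weight\<bar> \<le> 2 * slow_dist / al"
    using Dpos Kpos by (simp only: mult_le_cancel_left_pos mult_pos_pos)
  then have "weight k * \<bar>u k - 1 / ?weight\<bar> \<le> weight k * (2 * slow_dist / al)"
    using weight_pos[of k] by (intro mult_left_mono) auto
  moreover have "E (active k) - weight k / ?weight = weight k * (u k - 1 / ?weight)" by (simp add: q right_diff_distrib)
  ultimately show ?thesis using weight_pos[of k] by (simp add: abs_mult)
qed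

end

section \<open>The limits\<close>

lemma tendsto_of_bound:
  fixes f g :: "nat \<Rightarrow> real"
  assumes "\<And>m. 1 \<le> m \<Longrightarrow> \<bar>f m - c\<bar> \<le> g m" and "g \<longlonglongrightarrow> 0"
  shows "f \<longlonglongrightarrow> c"
proof (rule LIM_zero_cancel, rule Lim_null_comparison[OF _ assms(2)])
  show "eventually (\<lambda>m. norm (f m - c) \<le> g m) sequentially"
    using assms(1) by (auto intro: eventually_sequentiallyI[of 1])
qed

lemma fast_err_tendsto:
  assumes rs: "\<And>m. 1 \<le> m \<Longrightarrow> reward_system K lam al (\<beta> m) m (P m) (\<pi> m)"
    and lim: "filterlim (\<lambda>m. real m * \<beta> m) at_top sequentially"
  shows "(\<lambda>m. reward_system.fast_err K lam al (\<beta> m) m) \<longlonglongrightarrow> 0"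
proof -
  let ?L = "reward_system.lamsum K lam"
  have "((\<lambda>m. 1 / (real m * \<beta> m)) \<longlongrightarrow> 0) sequentially"
    using tendsto_divide_0[OF tendsto_const filterlim_at_top_imp_at_infinity[OF lim], of 1] .
  then have "(\<lambda>m. (?L + 2 * ?L\<^sup>2) / al\<^sup>2 * (1 / real m + 1 / (real m * \<beta> m)))
      \<longlonglongrightarrow> (?L + 2 * ?L\<^sup>2) / al\<^sup>2 * (0 + 0)"
    by (intro tendsto_mult tendsto_add tendsto_const lim_const_over_n)
  moreover have "eventually (\<lambda>m. (?L + 2 * ?L\<^sup>2) / al\<^sup>2 * (1 / real m + 1 / (real m * \<beta> m))
      = reward_system.fast_err K lam al (\<beta> m) m) sequentially"
    by (rule eventually_sequentiallyI[of 1]) (simp only: reward_system.fast_err_def[OF rs])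
  ultimately show ?thesis by (simp add: tendsto_cong)
qed

lemma abundant_dominant_limit:
  assumes rs: "\<And>m. 1 \<le> m \<Longrightarrow> reward_system K lam al (\<beta> m) m (P m) (\<pi> m)"
    and lim: "filterlim (\<lambda>m. real m * \<beta> m) at_top sequentially"
    and l: "\<And>j. j \<in> {1..K} \<Longrightarrow> lam j \<le> l" and i: "i \<in> {1..K}" "lam i = l"
    and dom: "real K * al \<le> l" and k: "k \<in> {1..K}" "lam k < l"
  shows "(\<lambda>m. measure_pmf.prob (\<pi> m) {w. snd w = k}) \<longlonglongrightarrow> al / l"
proof -
  define e where "e = (\<lambda>m. reward_system.fast_err K lam al (\<beta> m) m)"
  define D where "D = real K * al + reward_system.lamsum K lam + l"
  let ?g = "\<lambda>m. (lam k / l * (sqrt (e m) * D) + al * e m) / (1 - lam k / l) / (real K * al)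
      + sqrt (e m) * D / (real K * l)"
  have "e \<longlonglongrightarrow> 0" unfolding e_def by (rule fast_err_tendsto[OF rs lim])
  from tendsto_real_sqrt[OF this] this
  have "?g \<longlonglongrightarrow> (lam k / l * (0 * D) + al * 0) * inverse (1 - lam k / l) * inverse (real K * al)
      + 0 * D * inverse (real K * l)"
    unfolding divide_inverse[of _ "1 - lam k / l"] divide_inverse[of _ "real K * al"]
      divide_inverse[of _ "real K * l"] real_sqrt_zero
    by (intro tendsto_add tendsto_mult tendsto_const)
  then have g: "?g \<longlonglongrightarrow> 0" by (simp only: mult_zero_left mult_zero_right add_0_left)
  have bound: "\<bar>measure_pmf.prob (\<pi> m) {w. snd w = k} - al / l\<bar> \<le> ?g m" if "1 \<le> m" for m
    using reward_system.abundant_dominant_bound[OF rs[OF that] l i dom k]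
    unfolding reward_system.E_active[OF rs[OF that]] e_def D_def .
  show ?thesis by (rule tendsto_of_bound[OF bound g])
qed

lemma abundant_subcritical_limit:
  assumes rs: "\<And>m. 1 \<le> m \<Longrightarrow> reward_system K lam al (\<beta> m) m (P m) (\<pi> m)"
    and lim: "filterlim (\<lambda>m. real m * \<beta> m) at_top sequentially"
    and l: "\<And>j. j \<in> {1..K} \<Longrightarrow> lam j \<le> l" and sub: "l < real K * al" and k: "k \<in> {1..K}"
  shows "(\<lambda>m. measure_pmf.prob (\<pi> m) {w. snd w = k}) \<longlonglongrightarrow> 1 / real K"
proof -
  define e where "e = (\<lambda>m. reward_system.fast_err K lam al (\<beta> m) m)"
  let ?Y = "\<lambda>m. al * e m / (1 - l / (real K * al))"
  let ?g = "\<lambda>m. ?Y m / (real K * al) + al * (real K * ?Y m / (real K * al)\<^sup>2)"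
  have e: "e \<longlonglongrightarrow> 0" unfolding e_def by (rule fast_err_tendsto[OF rs lim])
  have "?Y \<longlonglongrightarrow> al * 0 * inverse (1 - l / (real K * al))"
    unfolding divide_inverse[of _ "1 - l / (real K * al)"]
    by (intro tendsto_mult tendsto_const e)
  then have "?Y \<longlonglongrightarrow> 0" by (simp only: mult_zero_left mult_zero_right)
  then have "?g \<longlonglongrightarrow> 0 * inverse (real K * al) + al * (real K * 0 * inverse ((real K * al)\<^sup>2))"
    unfolding divide_inverse[of _ "real K * al"] divide_inverse[of _ "(real K * al)\<^sup>2"]
    by (intro tendsto_add tendsto_mult tendsto_const)
  then have g: "?g \<longlonglongrightarrow> 0" by (simp only: mult_zero_left mult_zero_right add_0_left)
  have bound: "\<bar>measure_pmf.prob (\<pi> m) {w. snd w = k} - 1 / real K\<bar> \<le> ?g m" if "1 \<le> m" for m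
    using reward_system.abundant_subcritical_bound[OF rs[OF that] l sub k]
    unfolding reward_system.E_active[OF rs[OF that]] e_def .
  show ?thesis by (rule tendsto_of_bound[OF bound g])
qed

lemma deficient_limit:
  assumes rs: "\<And>m. 1 \<le> m \<Longrightarrow> reward_system K lam al (\<beta> m) m (P m) (\<pi> m)"
    and lim: "(\<lambda>m. real m * \<beta> m) \<longlonglongrightarrow> 0" and k: "k \<in> {1..K}"
  shows "(\<lambda>m. measure_pmf.prob (\<pi> m) {w. snd w = k}) \<longlonglongrightarrow>
      (max (lam k) al + (real K - 1) * al) / (\<Sum>i=1..K. (max (lam i) al + (real K - 1) * al))"
proof -
  let ?L = "reward_system.lamsum K lam"
  define e where "e = (\<lambda>m. 3 * ?L * (real m * \<beta> m) + 2 / real m)"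
  define d where "d = (\<lambda>m. 2 / (real K * al) * (real m * \<beta> m * ?L + sqrt (e m) * (?L + 1)))"
  let ?D = "\<lambda>i. max (lam i) al + (real K - 1) * al"
  let ?g = "\<lambda>m. ?D k * (2 * d m / al)"
  have "e \<longlonglongrightarrow> 3 * ?L * 0 + 0"
    unfolding e_def by (intro tendsto_add tendsto_mult tendsto_const lim lim_const_over_n)
  then have "e \<longlonglongrightarrow> 0" by (simp only: mult_zero_right add_0_left)
  from tendsto_real_sqrt[OF this]
  have "d \<longlonglongrightarrow> 2 / (real K * al) * (0 * ?L + 0 * (?L + 1))"
    unfolding d_def real_sqrt_zero by (intro tendsto_add tendsto_mult tendsto_const lim)
  then have "d \<longlonglongrightarrow> 0" by (simp only: mult_zero_left mult_zero_right add_0_left)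
  then have "?g \<longlonglongrightarrow> ?D k * (2 * 0 * inverse al)"
    unfolding divide_inverse[of _ al] by (intro tendsto_mult tendsto_const)
  then have g: "?g \<longlonglongrightarrow> 0" by (simp only: mult_zero_left mult_zero_right add_0_left)
  have bound: "\<bar>measure_pmf.prob (\<pi> m) {w. snd w = k} - ?D k / (\<Sum>i=1..K. ?D i)\<bar> \<le> ?g m"
    if "1 \<le> m" for m
    using reward_system.deficient_bound[OF rs[OF that] k]
    unfolding reward_system.E_active[OF rs[OF that]] reward_system.weight_def[OF rs[OF that]]
      reward_system.slow_dist_def[OF rs[OF that]] reward_system.slow_err_def[OF rs[OF that]]
      e_def d_def .
  show ?thesis by (rule tendsto_of_bound[OF bound g])
qed

theorem theorem2p1:
  fixes K :: nat and lam :: "nat \<Rightarrow> real" and \<alpha>0 :: real and \<beta> :: "nat \<Rightarrow> real"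
    and M :: "nat \<Rightarrow> 'w measure" and W :: "nat \<Rightarrow> real \<Rightarrow> 'w \<Rightarrow> state"
    and P :: "nat \<Rightarrow> real \<Rightarrow> state \<Rightarrow> state pmf" and \<pi> :: "nat \<Rightarrow> state pmf"
  assumes K: "K \<ge> 1"
    and lam_first: "K \<ge> 2 \<Longrightarrow> lam 1 > lam 2"
    and lam_dec: "\<And>k. 2 \<le> k \<Longrightarrow> k < K \<Longrightarrow> lam k \<ge> lam (k + 1)"
    and lam_pos: "lam K > 0"
    and alpha0: "\<alpha>0 > 0"
    and beta: "\<And>m. m \<ge> 1 \<Longrightarrow> \<beta> m > 0"
    and system: "\<And>m. m \<ge> 1 \<Longrightarrow>
      markov_jump_process (states K) (jump_rate K lam (\<alpha>0 * real m) (\<beta> m) m) (P m) (M m) (W m)"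
    and stationary: "\<And>m. m \<ge> 1 \<Longrightarrow> stationary_distribution (states K) (P m) (\<pi> m)"
    and regime: "filterlim (\<lambda>m. real m * \<beta> m) at_top sequentially \<or>
                 (\<lambda>m. real m * \<beta> m) \<longlonglongrightarrow> 0"
  shows "\<exists>c :: nat \<Rightarrow> real.
    (\<forall>k\<in>{1..K}. (\<lambda>m. measure_pmf.prob (\<pi> m) {w. snd w = k}) \<longlonglongrightarrow> c k) \<and>
    (filterlim (\<lambda>m. real m * \<beta> m) at_top sequentially \<longrightarrow>
       (\<alpha>0 \<le> lam 1 / real K \<longrightarrow>
          c 1 = 1 - (real K - 1) / lam 1 * \<alpha>0 \<and> (\<forall>k\<in>{2..K}. c k = \<alpha>0 / lam 1)) \<and>
       (\<alpha>0 > lam 1 / real K \<longrightarrow> (\<forall>k\<in>{1..K}. c k = 1 / real K))) \<and>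
    ((\<lambda>m. real m * \<beta> m) \<longlonglongrightarrow> 0 \<longrightarrow>
       (\<forall>k\<in>{1..K}. c k = (max (lam k) \<alpha>0 + (real K - 1) * \<alpha>0) /
          (\<Sum>i=1..K. (max (lam i) \<alpha>0 + (real K - 1) * \<alpha>0))))"
proof -
  have below2: "lam k \<le> lam 2" if "2 \<le> k" "k \<le> K" for k
    using that
  proof (induction k rule: dec_induct)
    case (step n)
    then show ?case using lam_dec[of n] by simp
  qed simp
  have less: "lam k < lam 1" if "k \<in> {2..K}" for k
    using below2[of k] lam_first that by simp
  have le: "lam k \<le> lam 1" if "k \<in> {1..K}" for k
    using less[of k] that by (cases "k = 1") auto
  have above: "lam K \<le> lam k" if "2 \<le> k" "k \<le> K" for k
    using that(2,1)
  proof (induction k rule: inc_induct)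
    case (step n)
    then show ?case using lam_dec[of n] by simp
  qed simp
  have pos: "0 < lam k" if "k \<in> {1..K}" for k
  proof (cases "k = 1")
    case True
    then show ?thesis using le[of K] lam_pos K by simp
  next
    case False
    then show ?thesis using above[of k] lam_pos that by simp
  qed
  have rs: "reward_system K lam \<alpha>0 (\<beta> m) m (P m) (\<pi> m)" if "1 \<le> m" for m
  proof -
    have "transition_function (states K) (jump_rate K lam (\<alpha>0 * real m) (\<beta> m) m) (P m)"
      using system[OF that] unfolding markov_jump_process_def by (rule conjunct1)
    then show ?thesis
      by (intro reward_system.intro K pos alpha0 beta stationary that)
  qed
  have one: "1 \<in> {1..K}" "lam 1 = lam 1" using K by auto
  have sum_prob: "(\<Sum>k=1..K. measure_pmf.prob (\<pi> m) {w. snd w = k}) = 1" if "1 \<le> m" for m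
    using reward_system.sum_E_active[OF rs[OF that]] unfolding reward_system.E_active[OF rs[OF that]] .
  from regime show ?thesis
  proof
    assume fast: "filterlim (\<lambda>m. real m * \<beta> m) at_top sequentially"
    have not_slow: "\<not> (\<lambda>m. real m * \<beta> m) \<longlonglongrightarrow> 0"
      using not_tendsto_and_filterlim_at_infinity[OF _ _ filterlim_at_top_imp_at_infinity[OF fast]]
      by auto
    show ?thesis
    proof (cases "\<alpha>0 \<le> lam 1 / real K")
      case True
      then have dom: "real K * \<alpha>0 \<le> lam 1" using K by (simp add: pos_le_divide_eq mult.commute)
      have lim: "(\<lambda>m. measure_pmf.prob (\<pi> m) {w. snd w = k}) \<longlonglongrightarrow> \<alpha>0 / lam 1"
        if "k \<in> {2..K}" for k
        by (rule abundant_dominant_limit[OF rs fast le one dom _ less]) (use that in auto)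
      \<comment> \<open>the best action receives the remaining probability\<close>
      have "(\<lambda>m. 1 - (\<Sum>k=2..K. measure_pmf.prob (\<pi> m) {w. snd w = k}))
          \<longlonglongrightarrow> 1 - (\<Sum>k=2..K. \<alpha>0 / lam 1)"
        by (intro tendsto_diff tendsto_const tendsto_sum lim)
      moreover have "eventually (\<lambda>m. 1 - (\<Sum>k=2..K. measure_pmf.prob (\<pi> m) {w. snd w = k})
          = measure_pmf.prob (\<pi> m) {w. snd w = 1}) sequentially"
      proof (rule eventually_sequentiallyI[of 1])
        fix m :: nat assume "1 \<le> m"
        have "{1..K} = insert 1 {2..K}" using K by auto
        then show "1 - (\<Sum>k=2..K. measure_pmf.prob (\<pi> m) {w. snd w = k})
            = measure_pmf.prob (\<pi> m) {w. snd w = 1}"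
          using sum_prob[OF \<open>1 \<le> m\<close>] by simp
      qed
      ultimately have "(\<lambda>m. measure_pmf.prob (\<pi> m) {w. snd w = 1})
          \<longlonglongrightarrow> 1 - (\<Sum>k=2..K. \<alpha>0 / lam 1)"
        by (rule Lim_transform_eventually)
      also have "1 - (\<Sum>k=2..K. \<alpha>0 / lam 1) = 1 - (real K - 1) / lam 1 * \<alpha>0"
        using K by (simp add: of_nat_diff)
      finally have lim1: "(\<lambda>m. measure_pmf.prob (\<pi> m) {w. snd w = 1})
          \<longlonglongrightarrow> 1 - (real K - 1) / lam 1 * \<alpha>0" .
      let ?c = "\<lambda>k. if k = 1 then 1 - (real K - 1) / lam 1 * \<alpha>0 else \<alpha>0 / lam 1"
      have "(\<lambda>m. measure_pmf.prob (\<pi> m) {w. snd w = k}) \<longlonglongrightarrow> ?c k"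
        if "k \<in> {1..K}" for k
        using lim[of k] lim1 that by (cases "k = 1") auto
      then show ?thesis using True not_slow by (intro exI[of _ ?c]) auto
    next
      case False
      then have sub: "lam 1 < real K * \<alpha>0" using K by (simp add: pos_divide_less_eq mult.commute not_le)
      show ?thesis
        using abundant_subcritical_limit[OF rs fast le sub] False not_slow
        by (intro exI[of _ "\<lambda>_. 1 / real K"]) auto
    qed
  next
    assume slow: "(\<lambda>m. real m * \<beta> m) \<longlonglongrightarrow> 0"
    have not_fast: "\<not> filterlim (\<lambda>m. real m * \<beta> m) at_top sequentially"
      using not_tendsto_and_filterlim_at_infinity[OF _ slow] filterlim_at_top_imp_at_infinity
      by auto
    show ?thesis
      using deficient_limit[OF rs slow] not_fast
      by (intro exI[of _ "\<lambda>k. (max (lam k) \<alpha>0 + (real K - 1) * \<alpha>0) /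
          (\<Sum>i=1..K. (max (lam i) \<alpha>0 + (real K - 1) * \<alpha>0))"]) auto
  qed
qed

end
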